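(* There exists a function $c_2\colon(0,1)\to(0,\infty)$ such that the following holds. Let $0<\varepsilon<1$. For any (deterministic) sequence $(A_n)_{n\in\mathbb N}$ of real $2\times 2$ matrices with $\|A_n\|\le 1$ for all $n$, the random variable $$\liminf_{n\to\infty}\frac 1n\log\frac{s_1(A_\varepsilon^{(n)})}{s_2(A_\varepsilon^{(n)})}$$ is almost surely constant, and the constant is at least $c_2(\varepsilon)$. Further, $c_2(\varepsilon)>\exp(-1/\varepsilon^{35})$ for all sufficiently small $\varepsilon>0$.
   Context: $\|M\|$ is the operator norm of a matrix $M$ induced by the Euclidean norm, and $s_1(M)\ge\dots\ge s_d(M)$ are the singular values of a $d\times d$ matrix $M$. $(\Xi_n)_{n\in\mathbb N}$ is a sequence of independent random $d\times d$ matrices (here $d=2$), each with mutually independent entries uniformly distributed on $[-1,1]$. Given a fixed sequence $(A_n)$, set $A_{n,\varepsilon}=A_n+\varepsilon\Xi_n$ and $A_\varepsilon^{(n)}=A_{n,\varepsilon}A_{n-1,\varepsilon}\cdots A_{1,\varepsilon}$. "Almost surely" refers to the randomness of $(\Xi_n)$. The quantity $c_2(\varepsilon)$ depends only on $\varepsilon$, not on the sequence $(A_n)$. *)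

theory Defs
  imports "HOL-Probability.Probability" "HOL-Library.Multiset"
begin

definition singular_value_space :: "real^'n^'m \<Rightarrow> real \<Rightarrow> (real^'n) set" where
  "singular_value_space M \<sigma> = {v. (transpose M ** M) *v v = \<sigma>\<^sup>2 *\<^sub>R v}"

text \<open>Square roots of the eigenvalues of \<open>M\<^sup>T M\<close>, each repeated according to the dimension of
  its eigenspace. As \<open>M\<^sup>T M\<close> is symmetric and positive semidefinite, this multiset has
  \<open>CARD('n)\<close> elements.\<close>

definition singular_values :: "real^'n^'m \<Rightarrow> real multiset" where
  "singular_values M =
    (\<Sum>\<sigma> | 0 \<le> \<sigma> \<and> (\<exists>v. v \<noteq> 0 \<and> v \<in> singular_value_space M \<sigma>).
       replicate_mset (dim (singular_value_space M \<sigma>)) \<sigma>)"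

text \<open>Decreasing enumeration, counted from \<open>1\<close>.\<close>

definition singular_value :: "nat \<Rightarrow> real^'n^'m \<Rightarrow> real" where
  "singular_value k M = rev (sorted_list_of_multiset (singular_values M)) ! (k - 1)"

text \<open>Sequences of matrices are indexed by the positive integers; the term at \<open>0\<close> is unused.\<close>

definition independent_uniform_matrices ::
    "'w measure \<Rightarrow> (nat \<Rightarrow> 'w \<Rightarrow> real^'n^'n) \<Rightarrow> bool" where
  "independent_uniform_matrices P \<Xi> \<longleftrightarrow>
     prob_space P \<and>
     prob_space.indep_vars P (\<lambda>_. borel) \<Xi> {1..} \<and>
     (\<forall>n\<ge>1. prob_space.indep_vars P (\<lambda>_. borel) (\<lambda>(i, j) \<omega>. \<Xi> n \<omega> $ i $ j) UNIV) \<and>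
     (\<forall>n\<ge>1. \<forall>i j. distr P lborel (\<lambda>\<omega>. \<Xi> n \<omega> $ i $ j) = uniform_measure lborel {-1..1})"

primrec perturbed_product ::
    "(nat \<Rightarrow> real^'n^'n) \<Rightarrow> (nat \<Rightarrow> real^'n^'n) \<Rightarrow> real \<Rightarrow> nat \<Rightarrow> real^'n^'n" where
  "perturbed_product A X \<epsilon> 0 = mat 1"
| "perturbed_product A X \<epsilon> (Suc n) =
     (A (Suc n) + \<epsilon> *\<^sub>R X (Suc n)) ** perturbed_product A X \<epsilon> n"

end

theory Submission
  imports Defs "HOL-Real_Asymp.Real_Asymp"
begin

text \<open>Let \<open>M\<close> be the product of the first \<open>n\<close> factors \<open>g = A + \<epsilon> \<Xi>\<close>. For a \<open>2 \<times> 2\<close> matrix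
\<open>s\<^sub>1 s\<^sub>2 = \<bar>det M\<bar>\<close>, and \<open>s\<^sub>1\<close> is comparable to the Frobenius norm, so \<open>s\<^sub>1 / s\<^sub>2\<close> may be replaced by the
\<^emph>\<open>eccentricity\<close> \<open>(norm M)\<^sup>2 / \<bar>det M\<bar>\<close>: the two differ by a factor of at most \<open>2\<close>, which
disappears in \<open>1/n log\<close>.

\<^emph>\<open>Lower bound.\<close> On functions \<open>F\<close> of the plane that are homogeneous of degree \<open>-1\<close>, with
\<open>\<parallel>F\<parallel>\<^sup>2\<close> the integral of \<open>F\<^sup>2\<close> over the annulus \<open>1 \<le> \<bar>x\<bar> < 2\<close>, an invertible matrix acts
isometrically by \<open>(T\<^sub>g F) x = F (g x) \<surd>\<bar>det g\<bar>\<close>. This is the quasi-regular representation on the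
square integrable functions of the projective line. As the factors are independent, the expectation
of \<open>T\<^sub>M\<close> is the composition of the averaged operators of the single factors. Each of these is a strict
contraction, by a factor \<open>\<surd>q\<close> with \<open>q = 1 - \<epsilon>\<^bsup>8\<^esup> / 2\<^bsup>56\<^esup>\<close> that does not depend on \<open>A\<close>: if
\<open>x\<close> and \<open>g x\<close> are given, \<open>F (g x)\<close> is fixed but \<open>\<bar>det g\<bar>\<close> still fluctuates, and so the
Cauchy-Schwarz inequality loses a definite amount (\<open>invariant_gap\<close>, \<open>gap_configuration\<close>,
\<open>spectral_gap\<close>). Applying the averaged operators to \<open>F x = 1 / \<bar>x\<bar>\<close> gives
\<open>E (\<surd>\<bar>det M\<bar> / norm M) \<le> 2 q\<^bsup>n/2\<^esup>\<close> (\<open>L2_decay\<close>, \<open>expectation_sqrt_det_over_norm\<close>).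
These expectations are summable against a slower geometric sequence, so the bound passes to almost
every trajectory, where the eccentricity grows at least at the exponential rate
\<open>\<epsilon>\<^bsup>8\<^esup> / 2\<^bsup>57\<^esup>\<close>. This polynomial bound dominates \<open>exp (-1 / \<epsilon>\<^bsup>35\<^esup>)\<close>.

\<^emph>\<open>Constancy.\<close> Removing finitely many invertible factors on the right changes the logarithm of the
eccentricity by a bounded amount only, so the lower limit is almost surely a tail function of the
independent sequence \<open>\<Xi>\<close> and obeys Kolmogorov's zero-one law. The constant is finite because
\<open>\<bar>det g\<bar>\<close> has an inverse square root moment of at most \<open>25 / \<epsilon>\<close>, again uniformly in \<open>A\<close>; this
moment also shows that the products are almost surely invertible.\<close>


section \<open>Two-by-two matrices, their singular values and eccentricity\<close>

lemma norm_sq_vec2: "(norm (x::real^2))\<^sup>2 = (x$1)\<^sup>2 + (x$2)\<^sup>2"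
  unfolding power2_norm_eq_inner by (simp add: inner_vec_def sum_2 power2_eq_square)

lemma norm_sq_mat2:
  "(norm (M::real^2^2))\<^sup>2 = (M$1$1)\<^sup>2 + (M$1$2)\<^sup>2 + (M$2$1)\<^sup>2 + (M$2$2)\<^sup>2"
  unfolding power2_norm_eq_inner by (simp add: inner_vec_def sum_2 power2_eq_square)

lemma cauchy_schwarz_two:
  fixes a b c d :: real
  shows "(a * c + b * d)\<^sup>2 \<le> (a\<^sup>2 + b\<^sup>2) * (c\<^sup>2 + d\<^sup>2)"
proof -
  have "(a\<^sup>2 + b\<^sup>2) * (c\<^sup>2 + d\<^sup>2) = (a * c + b * d)\<^sup>2 + (a * d - b * c)\<^sup>2"
    by algebra
  then show ?thesis by simp
qed

lemma norm_matrix_vector_mult_le: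
  fixes M :: "real^2^2"
  shows "norm (M *v x) \<le> norm M * norm x"
proof (rule power2_le_imp_le)
  have "(norm (M *v x))\<^sup>2 = (M$1$1 * x$1 + M$1$2 * x$2)\<^sup>2 + (M$2$1 * x$1 + M$2$2 * x$2)\<^sup>2"
    by (simp add: norm_sq_vec2 matrix_vector_mult_def sum_2)
  also have "\<dots> \<le> ((M$1$1)\<^sup>2 + (M$1$2)\<^sup>2) * ((x$1)\<^sup>2 + (x$2)\<^sup>2)
      + ((M$2$1)\<^sup>2 + (M$2$2)\<^sup>2) * ((x$1)\<^sup>2 + (x$2)\<^sup>2)"
    by (intro add_mono cauchy_schwarz_two)
  also have "\<dots> = (norm M * norm x)\<^sup>2"
    unfolding power_mult_distrib norm_sq_vec2 norm_sq_mat2 by algebra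
  finally show "(norm (M *v x))\<^sup>2 \<le> (norm M * norm x)\<^sup>2" .
qed simp

lemma norm_matrix_mult_le:
  fixes M N :: "real^2^2"
  shows "norm (M ** N) \<le> norm M * norm N"
proof (rule power2_le_imp_le)
  have "(norm (M ** N))\<^sup>2
      = (M$1$1 * N$1$1 + M$1$2 * N$2$1)\<^sup>2 + (M$1$1 * N$1$2 + M$1$2 * N$2$2)\<^sup>2
        + (M$2$1 * N$1$1 + M$2$2 * N$2$1)\<^sup>2 + (M$2$1 * N$1$2 + M$2$2 * N$2$2)\<^sup>2"
    by (simp add: norm_sq_mat2 matrix_matrix_mult_def sum_2)
  also have "\<dots> \<le> ((M$1$1)\<^sup>2 + (M$1$2)\<^sup>2) * ((N$1$1)\<^sup>2 + (N$2$1)\<^sup>2)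
      + ((M$1$1)\<^sup>2 + (M$1$2)\<^sup>2) * ((N$1$2)\<^sup>2 + (N$2$2)\<^sup>2)
      + ((M$2$1)\<^sup>2 + (M$2$2)\<^sup>2) * ((N$1$1)\<^sup>2 + (N$2$1)\<^sup>2)
      + ((M$2$1)\<^sup>2 + (M$2$2)\<^sup>2) * ((N$1$2)\<^sup>2 + (N$2$2)\<^sup>2)"
    by (intro add_mono cauchy_schwarz_two)
  also have "\<dots> = (norm M * norm N)\<^sup>2"
    unfolding power_mult_distrib norm_sq_mat2 by algebra
  finally show "(norm (M ** N))\<^sup>2 \<le> (norm M * norm N)\<^sup>2" .
qed simp

text \<open>An eigenspace in the plane is a line unless the matrix is scalar: it is neither zero nor
everything.\<close>
lemma dim_kernel_pencil:
  fixes S :: "real^2^2"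
  defines "K \<equiv> \<lambda>t. {v. S *v v = t *\<^sub>R v}"
  assumes S: "S \<noteq> mat t" and v: "v \<noteq> 0" "v \<in> K t"
  shows "dim (K t) = 1"
proof -
  have sub: "subspace (K t)"
    by (auto simp: subspace_def K_def matrix_vector_right_distrib matrix_vector_mult_scaleR
        scaleR_right_distrib)
  have "K t \<noteq> UNIV"
  proof
    assume U: "K t = UNIV"
    have "S *v w = mat t *v w" for w
    proof -
      have "mat t *v w = t *\<^sub>R w"
        by (simp add: matrix_vector_mult_def mat_def vec_eq_iff if_distrib if_distribR sum.delta
          cong: if_cong)
      moreover have "w \<in> K t" using U by simp
      ultimately show ?thesis by (simp add: K_def)
    qed
    then show False using S by (simp add: matrix_eq)
  qed
  then have "dim (K t) \<noteq> 2"
    using sub dim_eq_full[of "K t"] span_eq_iff[THEN iffD2, of "K t"] by simp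
  moreover have "dim (K t) \<le> 2"
    using dim_subset_UNIV[of "K t"] by simp
  moreover have "dim (K t) \<noteq> 0"
    using v by (auto simp: dim_eq_0)
  ultimately show ?thesis by linarith
qed

lemma ex_eigenvector_iff:
  fixes S :: "real^2^2"
  shows "(\<exists>v. v \<noteq> 0 \<and> S *v v = t *\<^sub>R v) \<longleftrightarrow> t\<^sup>2 - (S$1$1 + S$2$2) * t + det S = 0"
proof -
  have eq: "S *v v = t *\<^sub>R v \<longleftrightarrow> (S - mat t) *v v = 0" for v
    by (simp add: matrix_vector_mult_def mat_def vec_eq_iff sum_2 forall_2 algebra_simps)
  have "(\<exists>v. v \<noteq> 0 \<and> (S - mat t) *v v = 0) \<longleftrightarrow> det (S - mat t) = 0"
    by (metis invertible_det_nz matrix_left_invertible_ker invertible_left_inverse)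
  also have "det (S - mat t) = t\<^sup>2 - (S$1$1 + S$2$2) * t + det S"
    by (simp add: det_2 mat_def power2_eq_square algebra_simps)
  finally show ?thesis by (simp add: eq)
qed

text \<open>The eigenvalues of \<open>M\<^sup>T M\<close> are the roots of \<open>z\<^sup>2 - (norm M)\<^sup>2 z + (det M)\<^sup>2\<close>. A double root
forces \<open>M\<^sup>T M\<close> to be scalar, and then the only eigenspace is two-dimensional, so the multiset has
two elements in this case as well.\<close>
lemma singular_values_2:
  fixes M :: "real^2^2"
  assumes "det M \<noteq> 0"
  obtains s t where "singular_values M = {#s, t#}" "0 < t" "t \<le> s"
    "s\<^sup>2 + t\<^sup>2 = (norm M)\<^sup>2" "s * t = \<bar>det M\<bar>"
proof -
  define S where "S = transpose M ** M"
  define T where "T = (norm M)\<^sup>2"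
  define D where "D = (det M)\<^sup>2"
  have D: "det S = D" "0 < D"
    using assms by (simp_all add: S_def D_def det_mul det_transpose power2_eq_square[symmetric])
  have sym: "S$2$1 = S$1$2"
    by (simp add: S_def matrix_matrix_mult_def transpose_def sum_2 mult.commute)
  have tr: "S$1$1 + S$2$2 = T"
    unfolding S_def T_def norm_sq_mat2
    by (simp add: matrix_matrix_mult_def transpose_def sum_2 power2_eq_square)
  have disc: "T\<^sup>2 - 4 * D = (S$1$1 - S$2$2)\<^sup>2 + 4 * (S$1$2)\<^sup>2"
    unfolding tr[symmetric] D(1)[symmetric] by (simp add: det_2 sym) algebra
  then have disc0: "0 \<le> T\<^sup>2 - 4 * D" by simp
  define r where "r = sqrt (T\<^sup>2 - 4 * D)"
  have r: "0 \<le> r" "r\<^sup>2 = T\<^sup>2 - 4 * D" using disc0 by (auto simp: r_def)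
  have T0: "0 \<le> T" by (simp add: T_def)
  have "r\<^sup>2 < T\<^sup>2" using r D by simp
  then have rT: "r < T" using T0 power_less_imp_less_base by blast
  define s where "s = sqrt ((T + r) / 2)"
  define t where "t = sqrt ((T - r) / 2)"
  have s2: "s\<^sup>2 = (T + r) / 2" and t2: "t\<^sup>2 = (T - r) / 2"
    using rT r by (auto simp: s_def t_def)
  have t0: "0 < t" using rT by (simp add: t_def)
  have ts: "t \<le> s" using r by (auto simp: s_def t_def)
  have "(s * t)\<^sup>2 = (T\<^sup>2 - r\<^sup>2) / 4"
    by (simp add: power_mult_distrib s2 t2) (simp add: power2_eq_square field_simps)
  then have "(s * t)\<^sup>2 = \<bar>det M\<bar>\<^sup>2"
    using r by (simp add: D_def)
  then have st: "s * t = \<bar>det M\<bar>"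
    using t0 ts by (subst (asm) power2_eq_iff_nonneg) simp_all
  have spc: "singular_value_space M x = {v. S *v v = x\<^sup>2 *\<^sub>R v}" for x
    by (simp add: singular_value_space_def S_def)
  have char: "(\<exists>v. v \<noteq> 0 \<and> v \<in> singular_value_space M x) \<longleftrightarrow> x\<^sup>2 = s\<^sup>2 \<or> x\<^sup>2 = t\<^sup>2" for x
  proof -
    have "(\<exists>v. v \<noteq> 0 \<and> v \<in> singular_value_space M x) \<longleftrightarrow> (x\<^sup>2)\<^sup>2 - T * x\<^sup>2 + D = 0"
      unfolding spc mem_Collect_eq ex_eigenvector_iff tr D ..
    also have "(x\<^sup>2)\<^sup>2 - T * x\<^sup>2 + D = (x\<^sup>2 - s\<^sup>2) * (x\<^sup>2 - t\<^sup>2)"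
      using r(2) unfolding s2 t2 by (simp add: field_simps) algebra
    finally show ?thesis by simp
  qed
  have set: "{x. 0 \<le> x \<and> (\<exists>v. v \<noteq> 0 \<and> v \<in> singular_value_space M x)} = {s, t}"
    unfolding char using t0 ts by (auto simp: power2_eq_iff)
  have sv: "singular_values M = {#s, t#}"
  proof (cases "s = t")
    case True
    then have "r = 0" using s2 t2 by simp
    then have "(S$1$1 - S$2$2)\<^sup>2 + (2 * S$1$2)\<^sup>2 = 0"
      using disc r by (simp add: power_mult_distrib)
    then have "S$1$1 = S$2$2" "S$1$2 = 0" unfolding sum_power2_eq_zero_iff by simp_all
    then have "S *v v = (s\<^sup>2) *\<^sub>R v" for v
      using sym tr s2 \<open>r = 0\<close> by (simp add: vec_eq_iff forall_2 matrix_vector_mult_def sum_2)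
    then have "singular_value_space M s = UNIV" by (auto simp: spc)
    moreover have "dim (UNIV :: (real^2) set) = 2" by simp
    ultimately show ?thesis
      using True by (simp add: singular_values_def set numeral_2_eq_2 del: dim_UNIV)
  next
    case False
    have dim1: "dim (singular_value_space M x) = 1" if x: "x = s \<or> x = t" for x
    proof -
      obtain v where v: "v \<noteq> 0" "v \<in> singular_value_space M x" using char x by auto
      have "S \<noteq> mat (x\<^sup>2)"
      proof
        assume "S = mat (x\<^sup>2)"
        then have "r = 0" using disc by (simp add: r_def mat_def)
        then show False using False by (simp add: s_def t_def)
      qed
      then show ?thesis using dim_kernel_pencil[OF _ v(1)] v(2) unfolding spc by blast
    qed
    show ?thesis
      using False by (simp add: singular_values_def set dim1)
  qed
  have "s\<^sup>2 + t\<^sup>2 = (norm M)\<^sup>2" unfolding s2 t2 T_def by (simp add: field_simps)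
  then show thesis using that[OF sv t0 ts _ st] by blast
qed

definition eccentricity :: "real^2^2 \<Rightarrow> real" where
  "eccentricity M = (norm M)\<^sup>2 / \<bar>det M\<bar>"

lemma abs_ln_ratio_singular_values_eccentricity:
  assumes "det M \<noteq> 0"
  shows "\<bar>ln (singular_value 1 M / singular_value 2 M) - ln (eccentricity M)\<bar> \<le> ln 2"
proof -
  from singular_values_2[OF assms] obtain s t where st: "singular_values M = {#s, t#}"
    "0 < t" "t \<le> s" "s\<^sup>2 + t\<^sup>2 = (norm M)\<^sup>2" "s * t = \<bar>det M\<bar>" .
  have "sorted_list_of_multiset {#s, t#} = [t, s]" using st(3) by simp
  then have sv: "singular_value 1 M = s" "singular_value 2 M = t"
    by (simp_all add: singular_value_def st(1) numeral_2_eq_2)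
  have s0: "0 < s" using st by linarith
  have ecc: "eccentricity M = (s\<^sup>2 + t\<^sup>2) / (s * t)"
    by (simp add: eccentricity_def st)
  have tt: "t * t \<le> s * s" using st by (intro mult_mono) auto
  have "s / t \<le> eccentricity M"
    unfolding ecc using s0 st(2) by (simp add: field_simps power2_eq_square)
  then have 1: "ln (s / t) \<le> ln (eccentricity M)" using s0 st(2) by (intro ln_mono) simp_all
  have e0: "0 < eccentricity M" unfolding ecc using s0 st(2) by (simp add: add_pos_pos)
  have "eccentricity M \<le> 2 * (s / t)"
    unfolding ecc using s0 st(2) tt by (simp add: field_simps power2_eq_square)
  then have "ln (eccentricity M) \<le> ln (2 * (s / t))" using e0 by (intro ln_mono) simp_all
  also have "\<dots> = ln 2 + ln (s / t)" using s0 st(2) by (intro ln_mult_pos) simp_all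
  finally show ?thesis using 1 unfolding sv by linarith
qed

lemma norm_pos_of_det_nz: "det M \<noteq> 0 \<Longrightarrow> 0 < norm M" for M :: "real^2^2"
  by (auto simp: det_2)

lemma eccentricity_pos: "det M \<noteq> 0 \<Longrightarrow> 0 < eccentricity M"
  using norm_pos_of_det_nz[of M] by (auto simp: eccentricity_def)

text \<open>Changing the initial factors of a long product does not change the exponential growth rate:
the eccentricity is submultiplicative, which is used for \<open>N\<close> and for its inverse.\<close>
lemma bounded_distortion_right_factor:
  fixes N :: "real^2^2"
  assumes N: "det N \<noteq> 0"
  obtains C where "\<And>M. det M \<noteq> 0 \<Longrightarrow> \<bar>ln (eccentricity (M ** N)) - ln (eccentricity M)\<bar> \<le> C"
proof -
  obtain N' where N': "N ** N' = mat 1"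
    using N by (metis invertible_det_nz invertible_def)
  have "det N * det N' = 1" by (metis N' det_mul det_I)
  then have dN: "det N' \<noteq> 0" by auto
  have le: "ln (eccentricity (M ** K)) \<le> ln (eccentricity M) + ln (eccentricity K)"
    if M: "det M \<noteq> 0" and K: "det K \<noteq> 0" for M K :: "real^2^2"
  proof -
    have "(norm (M ** K))\<^sup>2 \<le> (norm M)\<^sup>2 * (norm K)\<^sup>2"
      using power_mono[OF norm_matrix_mult_le[of M K], of 2] by (simp add: power_mult_distrib)
    then have "eccentricity (M ** K) \<le> eccentricity M * eccentricity K"
      by (simp add: eccentricity_def det_mul abs_mult divide_right_mono)
    moreover have "0 < eccentricity (M ** K)" "0 < eccentricity M" "0 < eccentricity K"
      using M K by (auto intro!: eccentricity_pos simp: det_mul)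
    ultimately show ?thesis by (metis ln_mult_pos ln_mono mult_pos_pos)
  qed
  show thesis
  proof (rule that[of "max (ln (eccentricity N)) (ln (eccentricity N'))"])
    fix M :: "real^2^2" assume M: "det M \<noteq> 0"
    have MN: "(M ** N) ** N' = M" by (metis N' matrix_mul_assoc matrix_mul_rid)
    have "ln (eccentricity M) \<le> ln (eccentricity (M ** N)) + ln (eccentricity N')"
      using le[of "M ** N" N'] M N dN MN by (auto simp: det_mul)
    moreover have "ln (eccentricity (M ** N)) \<le> ln (eccentricity M) + ln (eccentricity N)"
      using le[OF M N] .
    ultimately show "\<bar>ln (eccentricity (M ** N)) - ln (eccentricity M)\<bar>
        \<le> max (ln (eccentricity N)) (ln (eccentricity N'))"
      by linarith
  qed
qed

section \<open>Measurability\<close>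

lemma measurable_vec_nth [measurable]:
  "f \<in> borel_measurable M \<Longrightarrow> (\<lambda>x. f x $ i) \<in> borel_measurable M"
  for f :: "'a \<Rightarrow> 'b::topological_space^'n"
  by (rule measurable_compose[OF _ borel_measurable_continuous_onI]) (auto intro: continuous_on_component)

lemma measurable_matrix_matrix_mult [measurable]:
  fixes f g :: "'a \<Rightarrow> real^2^2"
  assumes f: "f \<in> borel_measurable M" and g: "g \<in> borel_measurable M"
  shows "(\<lambda>x. f x ** g x) \<in> borel_measurable M"
  unfolding matrix_matrix_mult_def
  by (rule borel_measurable_continuous_Pair[OF f g]) (intro continuous_intros)

lemma measurable_matrix_vector_mult [measurable]:
  fixes f :: "'a \<Rightarrow> real^2^2"
  assumes f: "f \<in> borel_measurable M" and g: "g \<in> borel_measurable M"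
  shows "(\<lambda>x. f x *v g x) \<in> borel_measurable M"
  unfolding matrix_vector_mult_def
  by (rule borel_measurable_continuous_Pair[OF f g]) (intro continuous_intros)

lemma measurable_det [measurable]:
  fixes f :: "'a \<Rightarrow> real^2^2"
  assumes [measurable]: "f \<in> borel_measurable M"
  shows "(\<lambda>x. det (f x)) \<in> borel_measurable M"
  by (simp add: det_2)

lemma measurable_eccentricity [measurable]:
  assumes [measurable]: "f \<in> borel_measurable M"
  shows "(\<lambda>x. eccentricity (f x)) \<in> borel_measurable M"
  unfolding eccentricity_def by measurable

lemma measurable_perturbed_product:
  assumes "\<And>i. i \<in> {1..n} \<Longrightarrow> X i \<in> borel_measurable M"
  shows "(\<lambda>x. perturbed_product A (\<lambda>i. X i x) \<epsilon> n :: real^2^2) \<in> borel_measurable M"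
  using assms
proof (induction n)
  case (Suc n)
  note [measurable] = Suc.prems[of "Suc n", simplified]
  have [measurable]: "(\<lambda>x. perturbed_product A (\<lambda>i. X i x) \<epsilon> n :: real^2^2) \<in> borel_measurable M"
    by (rule Suc.IH) (use Suc.prems in auto)
  show ?case by simp
qed simp

section \<open>The uniform distribution on matrices with entries in [-1, 1]\<close>

abbreviation uniform_pm1 :: "real measure" where
  "uniform_pm1 \<equiv> uniform_measure lborel {-1..1}"

definition mat2 :: "real \<Rightarrow> real \<Rightarrow> real \<Rightarrow> real \<Rightarrow> real^2^2" where
  "mat2 a b c d = vector [vector [a, b], vector [c, d]]"

lemma mat2_nth [simp]:
  "mat2 a b c d $ 1 $ 1 = a" "mat2 a b c d $ 1 $ 2 = b"
  "mat2 a b c d $ 2 $ 1 = c" "mat2 a b c d $ 2 $ 2 = d"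
  by (simp_all add: mat2_def)

lemma mat2_eta: "mat2 (X$1$1) (X$1$2) (X$2$1) (X$2$2) = X"
  by (simp add: vec_eq_iff forall_2)

lemma measurable_mat2 [measurable]:
  assumes [measurable]: "f \<in> borel_measurable M" "g \<in> borel_measurable M"
    "h \<in> borel_measurable M" "k \<in> borel_measurable M"
  shows "(\<lambda>x. mat2 (f x) (g x) (h x) (k x)) \<in> borel_measurable M"
proof -
  have "(\<lambda>x. mat2 (f x) (g x) (h x) (k x)) = (\<lambda>x. f x *\<^sub>R mat2 1 0 0 0 + g x *\<^sub>R mat2 0 1 0 0
      + h x *\<^sub>R mat2 0 0 1 0 + k x *\<^sub>R mat2 0 0 0 1)"
    by (simp add: fun_eq_iff vec_eq_iff forall_2)
  then show ?thesis by simp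
qed

lemma prob_space_uniform_pm1: "prob_space uniform_pm1"
  by (rule prob_space_uniform_measure) auto

text \<open>The law of one noise matrix, built as an image of a product of four measures so that its
integrals are iterated one-dimensional integrals.\<close>
definition uniform_mat2 :: "(real^2^2) measure" where
  "uniform_mat2 = distr (uniform_pm1 \<Otimes>\<^sub>M uniform_pm1 \<Otimes>\<^sub>M uniform_pm1 \<Otimes>\<^sub>M uniform_pm1) borel
     (\<lambda>(a, b, c, d). mat2 a b c d)"

lemma sets_uniform_mat2 [simp, measurable_cong]: "sets uniform_mat2 = sets borel"
  by (simp add: uniform_mat2_def)

lemma nn_integral_uniform_mat2:
  assumes [measurable]: "f \<in> borel_measurable borel"
  shows "(\<integral>\<^sup>+X. f X \<partial>uniform_mat2)
    = (\<integral>\<^sup>+a. \<integral>\<^sup>+b. \<integral>\<^sup>+c. \<integral>\<^sup>+d. f (mat2 a b c d)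
        \<partial>uniform_pm1 \<partial>uniform_pm1 \<partial>uniform_pm1 \<partial>uniform_pm1)"
proof -
  interpret U: prob_space uniform_pm1 by (rule prob_space_uniform_pm1)
  interpret U2: pair_prob_space uniform_pm1 uniform_pm1 ..
  interpret U3: pair_prob_space uniform_pm1 "uniform_pm1 \<Otimes>\<^sub>M uniform_pm1" ..
  show ?thesis
    by (simp add: uniform_mat2_def nn_integral_distr split_beta'
        U3.nn_integral_fst[symmetric]
        U2.nn_integral_fst[symmetric] U.nn_integral_fst[symmetric])
qed

lemma prob_space_uniform_mat2: "prob_space uniform_mat2"
proof -
  interpret U: prob_space uniform_pm1 by (rule prob_space_uniform_pm1)
  have "(\<integral>\<^sup>+X. 1 \<partial>uniform_mat2) = 1"
    by (subst nn_integral_uniform_mat2) (simp_all add: U.emeasure_space_1[simplified])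
  then show ?thesis by (intro prob_spaceI) simp
qed

lemma exhaust_2x2: "(UNIV :: (2 \<times> 2) set) = {(1,1),(1,2),(2,1),(2,2)}"
proof -
  have "(UNIV :: (2 \<times> 2) set) = UNIV \<times> UNIV" by simp
  then show ?thesis unfolding UNIV_2 by auto
qed

text \<open>The link between the probabilistic hypotheses (independent uniform entries) and the concrete
measure: the joint law of the entries is a product measure over the four index pairs.\<close>
lemma distr_uniform_mat2:
  fixes X :: "'w \<Rightarrow> real^2^2"
  assumes P: "prob_space P"
    and indep: "prob_space.indep_vars P (\<lambda>_. borel) (\<lambda>(i, j) \<omega>. X \<omega> $ i $ j) UNIV"
    and unif: "\<And>i j. distr P lborel (\<lambda>\<omega>. X \<omega> $ i $ j) = uniform_pm1"
  shows "X \<in> borel_measurable P" "distr P borel X = uniform_mat2"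
proof -
  interpret P: prob_space P by (rule P)
  interpret U: prob_space uniform_pm1 by (rule prob_space_uniform_pm1)
  interpret UP: product_prob_space "\<lambda>_::2\<times>2. uniform_pm1" UNIV ..
  have rv [measurable]: "(\<lambda>\<omega>. X \<omega> $ i $ j) \<in> borel_measurable P" for i j
    using indep by (auto simp: P.indep_vars_def)
  have "X = (\<lambda>\<omega>. mat2 (X \<omega> $1$1) (X \<omega> $1$2) (X \<omega> $2$1) (X \<omega> $2$2))"
    by (simp add: mat2_eta)
  also have "\<dots> \<in> borel_measurable P" by simp
  finally show X [measurable]: "X \<in> borel_measurable P" .
  let ?Y = "\<lambda>(i, j) \<omega>. X \<omega> $ i $ j"
  have U': "distr P borel (?Y ij) = uniform_pm1" for ij
    using unif[of "fst ij" "snd ij"] distr_cong[of P P borel lborel "?Y ij" "?Y ij"]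
    by (simp add: split_beta')
  have joint: "distr P (\<Pi>\<^sub>M ij\<in>UNIV. borel) (\<lambda>\<omega>. \<lambda>ij\<in>UNIV. ?Y ij \<omega>) = (\<Pi>\<^sub>M ij\<in>UNIV. uniform_pm1)"
    using P.indep_vars_iff_distr_eq_PiM[of UNIV ?Y "\<lambda>_. borel"] indep rv
    by (simp add: U'[unfolded split_beta'] split_beta')
  let ?m = "\<lambda>y :: 2 \<times> 2 \<Rightarrow> real. mat2 (y (1,1)) (y (1,2)) (y (2,1)) (y (2,2))"
  have *: "(\<integral>\<^sup>+\<omega>. f (X \<omega>) \<partial>P) = (\<integral>\<^sup>+X. f X \<partial>uniform_mat2)"
    if [measurable]: "f \<in> borel_measurable borel" for f :: "real^2^2 \<Rightarrow> ennreal"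
  proof -
    have "(\<integral>\<^sup>+\<omega>. f (X \<omega>) \<partial>P)
        = (\<integral>\<^sup>+y. f (?m y) \<partial>distr P (\<Pi>\<^sub>M ij\<in>UNIV. borel) (\<lambda>\<omega>. \<lambda>ij\<in>UNIV. ?Y ij \<omega>))"
      by (subst nn_integral_distr) (auto simp: mat2_eta split_beta')
    also have "\<dots> = (\<integral>\<^sup>+y. f (?m y) \<partial>(\<Pi>\<^sub>M ij\<in>{(1,1),(1,2),(2,1),(2,2)}. uniform_pm1))"
      unfolding joint unfolding exhaust_2x2 ..
    also have "\<dots> = (\<integral>\<^sup>+X. f X \<partial>uniform_mat2)"
      by (simp add: nn_integral_uniform_mat2 UP.product_nn_integral_insert_rev
          UP.nn_integral_empty prob_space.emeasure_space_1[OF prob_space_PiM]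
          prob_space_uniform_pm1)
    finally show ?thesis .
  qed
  show "distr P borel X = uniform_mat2"
  proof (rule measure_eqI)
    fix B assume "B \<in> sets (distr P borel X)"
    then have [measurable]: "B \<in> sets borel" by simp
    have "emeasure (distr P borel X) B = (\<integral>\<^sup>+\<omega>. indicator B (X \<omega>) \<partial>P)"
      using nn_integral_distr[of X P borel "indicator B"] by simp
    then show "emeasure (distr P borel X) B = emeasure uniform_mat2 B"
      by (simp add: *)
  qed simp
qed

section \<open>Swapping two boxes of noise\<close>

lemma uniform_pm1_translate:
  fixes h :: "real \<Rightarrow> ennreal"
  assumes [measurable]: "h \<in> borel_measurable borel"
    and sub: "{l..u} \<subseteq> {-1..1}" "{l + d..u + d} \<subseteq> {-1..1}"
  shows "(\<integral>\<^sup>+a. indicator {l..u} a * h (a + d) \<partial>uniform_pm1)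
    = (\<integral>\<^sup>+a. indicator {l + d..u + d} a * h a \<partial>uniform_pm1)"
proof -
  have "(\<integral>\<^sup>+a. indicator {l + d..u + d} a * h a * indicator {-1..1} a \<partial>lborel)
      = (\<integral>\<^sup>+a. indicator {l + d..u + d} a * h a \<partial>lborel)"
    using sub by (intro nn_integral_cong) (auto split: split_indicator)
  also have "\<dots> = (\<integral>\<^sup>+a. indicator {l + d..u + d} (d + a) * h (d + a) \<partial>lborel)"
    by (subst nn_integral_real_affine[where c = 1 and t = d]) simp_all
  also have "\<dots> = (\<integral>\<^sup>+a. indicator {l..u} a * h (a + d) * indicator {-1..1} a \<partial>lborel)"
    using sub by (intro nn_integral_cong) (auto split: split_indicator simp: add.commute)
  finally show ?thesis
    by (simp add: nn_integral_uniform_measure)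
qed

text \<open>Boxes are cubes in the coordinates, so that translation acts on each entry separately.\<close>
definition entry_box :: "real \<Rightarrow> real^2^2 \<Rightarrow> (real^2^2) set" where
  "entry_box \<eta> C = {X. \<forall>i j. \<bar>X$i$j - C$i$j\<bar> \<le> \<eta>}"

lemma entry_box_measurable [measurable]: "entry_box \<eta> C \<in> sets borel"
proof -
  have "entry_box \<eta> C = {X \<in> space borel. \<forall>i j. \<bar>X$i$j - C$i$j\<bar> \<le> \<eta>}"
    by (simp add: entry_box_def)
  also have "\<dots> \<in> sets borel" by measurable
  finally show ?thesis .
qed

lemma indicator_entry_box:
  "(indicator (entry_box \<eta> C) (mat2 a b c d) :: ennreal)
    = indicator {C$1$1 - \<eta>..C$1$1 + \<eta>} a * (indicator {C$1$2 - \<eta>..C$1$2 + \<eta>} b *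
      (indicator {C$2$1 - \<eta>..C$2$1 + \<eta>} c * indicator {C$2$2 - \<eta>..C$2$2 + \<eta>} d))"
  by (auto simp: entry_box_def forall_2 abs_le_iff split: split_indicator)

text \<open>The cube of radius \<open>\<eta>\<close> around \<open>C\<close> lies inside the support of the noise.\<close>
definition support_box :: "real \<Rightarrow> real^2^2 \<Rightarrow> bool" where
  "support_box \<eta> C \<longleftrightarrow> 0 \<le> \<eta> \<and> (\<forall>i j. \<bar>C$i$j\<bar> + \<eta> \<le> 1)"

lemma nn_integral_entry_box:
  assumes [measurable]: "f \<in> borel_measurable borel"
  shows "(\<integral>\<^sup>+X. indicator (entry_box \<eta> C) X * f X \<partial>uniform_mat2)
    = (\<integral>\<^sup>+a. indicator {C$1$1 - \<eta>..C$1$1 + \<eta>} a *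
        (\<integral>\<^sup>+b. indicator {C$1$2 - \<eta>..C$1$2 + \<eta>} b *
          (\<integral>\<^sup>+c. indicator {C$2$1 - \<eta>..C$2$1 + \<eta>} c *
            (\<integral>\<^sup>+d. indicator {C$2$2 - \<eta>..C$2$2 + \<eta>} d * f (mat2 a b c d)
        \<partial>uniform_pm1) \<partial>uniform_pm1) \<partial>uniform_pm1) \<partial>uniform_pm1)"
proof -
  interpret U: prob_space uniform_pm1 by (rule prob_space_uniform_pm1)
  show ?thesis
    by (simp add: nn_integral_uniform_mat2 indicator_entry_box mult.assoc nn_integral_cmult)
qed

lemma emeasure_entry_box:
  assumes "support_box \<eta> C"
  shows "emeasure uniform_mat2 (entry_box \<eta> C) = ennreal (\<eta> ^ 4)"
proof -
  have U: "emeasure uniform_pm1 {C$i$j - \<eta>..C$i$j + \<eta>} = ennreal \<eta>" for i j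
  proof -
    have "\<bar>C$i$j\<bar> + \<eta> \<le> 1" "0 \<le> \<eta>" using assms by (auto simp: support_box_def)
    then have "{-1..1} \<inter> {C$i$j - \<eta>..C$i$j + \<eta>} = {C$i$j - \<eta>..C$i$j + \<eta>}" by auto
    then show ?thesis
      using \<open>0 \<le> \<eta>\<close> by (simp add: emeasure_uniform_measure ennreal_times_divide
          divide_ennreal ennreal_numeral[symmetric] del: ennreal_numeral)
  qed
  have "emeasure uniform_mat2 (entry_box \<eta> C)
      = (\<integral>\<^sup>+X. indicator (entry_box \<eta> C) X * 1 \<partial>uniform_mat2)"
    by simp
  also have "\<dots> = ennreal \<eta> * (ennreal \<eta> * (ennreal \<eta> * ennreal \<eta>))"
    by (subst nn_integral_entry_box) (simp_all add: U nn_integral_multc)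
  also have "\<dots> = ennreal (\<eta> ^ 4)"
    using assms by (simp add: support_box_def ennreal_mult[symmetric] numeral_eq_Suc)
  finally show ?thesis .
qed

text \<open>Inside its support the law of the noise is a multiple of Lebesgue measure, hence invariant
under translations that stay inside the support.\<close>
lemma uniform_mat2_translate:
  fixes f :: "real^2^2 \<Rightarrow> ennreal"
  assumes [measurable]: "f \<in> borel_measurable borel"
    and C: "support_box \<eta> C" and CD: "support_box \<eta> (C + D)"
  shows "(\<integral>\<^sup>+X. indicator (entry_box \<eta> C) X * f (X + D) \<partial>uniform_mat2)
    = (\<integral>\<^sup>+X. indicator (entry_box \<eta> (C + D)) X * f X \<partial>uniform_mat2)"
proof -
  interpret U: prob_space uniform_pm1 by (rule prob_space_uniform_pm1)
  have sub: "{C$i$j - \<eta>..C$i$j + \<eta>} \<subseteq> {-1..1}"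
    "{C$i$j - \<eta> + D$i$j..C$i$j + \<eta> + D$i$j} \<subseteq> {-1..1}" for i j
  proof -
    have "\<bar>C$i$j\<bar> + \<eta> \<le> 1" "\<bar>C$i$j + D$i$j\<bar> + \<eta> \<le> 1"
      using C CD by (auto simp: support_box_def)
    then show "{C$i$j - \<eta>..C$i$j + \<eta>} \<subseteq> {-1..1}"
      "{C$i$j - \<eta> + D$i$j..C$i$j + \<eta> + D$i$j} \<subseteq> {-1..1}"
      by auto
  qed
  have eq: "{C$i$j - \<eta> + D$i$j..C$i$j + \<eta> + D$i$j} = {(C + D)$i$j - \<eta>..(C + D)$i$j + \<eta>}" for i j
    by (simp add: algebra_simps)
  have tr: "(\<integral>\<^sup>+a. indicator {C$i$j - \<eta>..C$i$j + \<eta>} a * h (a + D$i$j) \<partial>uniform_pm1)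
      = (\<integral>\<^sup>+a. indicator {(C + D)$i$j - \<eta>..(C + D)$i$j + \<eta>} a * h a \<partial>uniform_pm1)"
    if "h \<in> borel_measurable borel" for h i j
    using uniform_pm1_translate[OF that sub, of i j] unfolding eq .
  have shift: "mat2 a b c d + D = mat2 (a + D$1$1) (b + D$1$2) (c + D$2$1) (d + D$2$2)" for a b c d
    by (simp add: vec_eq_iff forall_2)
  have "(\<integral>\<^sup>+X. indicator (entry_box \<eta> C) X * f (X + D) \<partial>uniform_mat2)
      = (\<integral>\<^sup>+a. indicator {C$1$1 - \<eta>..C$1$1 + \<eta>} a *
        (\<integral>\<^sup>+b. indicator {C$1$2 - \<eta>..C$1$2 + \<eta>} b *
          (\<integral>\<^sup>+c. indicator {C$2$1 - \<eta>..C$2$1 + \<eta>} c *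
            (\<integral>\<^sup>+d. indicator {C$2$2 - \<eta>..C$2$2 + \<eta>} d *
              f (mat2 (a + D$1$1) (b + D$1$2) (c + D$2$1) (d + D$2$2))
        \<partial>uniform_pm1) \<partial>uniform_pm1) \<partial>uniform_pm1) \<partial>uniform_pm1)"
    by (subst nn_integral_entry_box) (simp_all add: shift)
  also have "\<dots> = (\<integral>\<^sup>+X. indicator (entry_box \<eta> (C + D)) X * f X \<partial>uniform_mat2)"
    \<comment> \<open>The entries are translated one at a time, from the outermost integral inwards.\<close>
    apply (subst nn_integral_entry_box, simp)
    apply (subst tr[of "\<lambda>a. (\<integral>\<^sup>+b. indicator {C$1$2 - \<eta>..C$1$2 + \<eta>} b *
          (\<integral>\<^sup>+c. indicator {C$2$1 - \<eta>..C$2$1 + \<eta>} c *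
            (\<integral>\<^sup>+d. indicator {C$2$2 - \<eta>..C$2$2 + \<eta>} d *
              f (mat2 a (b + D$1$2) (c + D$2$1) (d + D$2$2))
        \<partial>uniform_pm1) \<partial>uniform_pm1) \<partial>uniform_pm1)"], measurable)
    apply (subst tr[of "\<lambda>b. (\<integral>\<^sup>+c. indicator {C$2$1 - \<eta>..C$2$1 + \<eta>} c *
            (\<integral>\<^sup>+d. indicator {C$2$2 - \<eta>..C$2$2 + \<eta>} d *
              f (mat2 _ b (c + D$2$1) (d + D$2$2))
        \<partial>uniform_pm1) \<partial>uniform_pm1)"], measurable)
    apply (subst tr[of "\<lambda>c. (\<integral>\<^sup>+d. indicator {C$2$2 - \<eta>..C$2$2 + \<eta>} d *
              f (mat2 _ _ c (d + D$2$2)) \<partial>uniform_pm1)"], measurable)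
    apply (subst tr, measurable)
    done
  finally show ?thesis .
qed

text \<open>A measure-preserving involution of the noise if the two boxes are disjoint. Later \<open>D\<close> is
chosen with \<open>D *v x = 0\<close>, so that the swap moves the determinant of \<open>A + \<epsilon> X\<close> but not the image
of \<open>x\<close>.\<close>
definition box_swap :: "real \<Rightarrow> real^2^2 \<Rightarrow> real^2^2 \<Rightarrow> real^2^2 \<Rightarrow> real^2^2" where
  "box_swap \<eta> C D X =
    (if X \<in> entry_box \<eta> C then X + D else if X \<in> entry_box \<eta> (C + D) then X - D else X)"

lemma measurable_box_swap [measurable]: "box_swap \<eta> C D \<in> borel_measurable borel"
  unfolding box_swap_def[abs_def] by measurable

lemma nn_integral_box_swap:
  fixes f :: "real^2^2 \<Rightarrow> ennreal"
  assumes [measurable]: "f \<in> borel_measurable borel"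
    and C: "support_box \<eta> C" and CD: "support_box \<eta> (C + D)"
    and disj: "entry_box \<eta> C \<inter> entry_box \<eta> (C + D) = {}"
  shows "(\<integral>\<^sup>+X. f (box_swap \<eta> C D X) \<partial>uniform_mat2) = (\<integral>\<^sup>+X. f X \<partial>uniform_mat2)"
proof -
  let ?B = "entry_box \<eta> C" and ?B' = "entry_box \<eta> (C + D)"
  let ?R = "- (?B \<union> ?B')"
  have "(\<integral>\<^sup>+X. f (box_swap \<eta> C D X) \<partial>uniform_mat2)
      = (\<integral>\<^sup>+X. indicator ?B X * f (X + D) + indicator ?B' X * f (X - D) + indicator ?R X * f X \<partial>uniform_mat2)"
    using disj by (intro nn_integral_cong) (auto simp: box_swap_def split: split_indicator)
  also have "\<dots> = (\<integral>\<^sup>+X. indicator ?B X * f (X + D) \<partial>uniform_mat2)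
      + (\<integral>\<^sup>+X. indicator ?B' X * f (X - D) \<partial>uniform_mat2) + (\<integral>\<^sup>+X. indicator ?R X * f X \<partial>uniform_mat2)"
    by (simp add: nn_integral_add)
  also have "\<dots> = (\<integral>\<^sup>+X. indicator ?B' X * f X \<partial>uniform_mat2)
      + (\<integral>\<^sup>+X. indicator ?B X * f X \<partial>uniform_mat2) + (\<integral>\<^sup>+X. indicator ?R X * f X \<partial>uniform_mat2)"
    using uniform_mat2_translate[of f \<eta> C D] uniform_mat2_translate[of f \<eta> "C + D" "-D"] C CD
    by simp
  also have "\<dots> = (\<integral>\<^sup>+X. indicator ?B' X * f X + indicator ?B X * f X + indicator ?R X * f X \<partial>uniform_mat2)"
    by (simp add: nn_integral_add)
  also have "\<dots> = (\<integral>\<^sup>+X. f X \<partial>uniform_mat2)"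
    using disj by (intro nn_integral_cong) (auto split: split_indicator)
  finally show ?thesis .
qed

section \<open>The spectral gap of one averaged factor\<close>

text \<open>The Cauchy-Schwarz inequality gives the claim with factor \<open>1\<close>. Since \<open>a\<close> is invariant under
\<open>\<tau>\<close>, one may first replace \<open>Z\<close> by its mean along \<open>\<tau>\<close>. On \<open>B\<close> the square of this mean is smaller
than the mean of the squares by the factor \<open>1 - \<kappa>\<close>, which saves \<open>\<kappa>\<close> times the measure of
\<open>B\<close>.\<close>
lemma invariant_gap:
  fixes a :: "'a \<Rightarrow> ennreal" and Z :: "'a \<Rightarrow> real"
  assumes M: "prob_space M"
    and [measurable]: "\<tau> \<in> M \<rightarrow>\<^sub>M M" "a \<in> borel_measurable M" "Z \<in> borel_measurable M" "B \<in> sets M"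
    and inv: "\<And>f. f \<in> borel_measurable M \<Longrightarrow> (\<integral>\<^sup>+x. f (\<tau> x) \<partial>M) = (\<integral>\<^sup>+x. f x \<partial>M)"
    and a: "\<And>x. a (\<tau> x) = a x"
    and Z: "\<And>x. 0 \<le> Z x"
    and \<kappa>: "0 \<le> \<kappa>" "\<kappa> \<le> 1"
    and gap: "\<And>x. x \<in> B \<Longrightarrow> (Z x + Z (\<tau> x))\<^sup>2 / 2 \<le> (1 - \<kappa>) * ((Z x)\<^sup>2 + (Z (\<tau> x))\<^sup>2)"
  shows "(\<integral>\<^sup>+x. a x * ennreal (Z x) \<partial>M)\<^sup>2
    \<le> ennreal (1 - \<kappa> * measure M B) * (\<integral>\<^sup>+x. (a x)\<^sup>2 * ennreal ((Z x)\<^sup>2) \<partial>M)"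
proof -
  interpret prob_space M by (rule M)
  define h :: real where "h = 1 / 2"
  have h: "0 \<le> h" "h + h = 1" "h\<^sup>2 = h / 2" by (simp_all add: h_def power2_eq_square)
  \<comment> \<open>The weight \<open>w\<close> carries the gain on \<open>B\<close>; \<open>q\<close> is the quadratic mean of \<open>Z\<close> along \<open>\<tau>\<close>.\<close>
  define w where "w x = (if x \<in> B then sqrt (1 - \<kappa>) else 1)" for x
  define q where "q x = sqrt (h * ((Z x)\<^sup>2 + (Z (\<tau> x))\<^sup>2))" for x
  have [measurable]: "w \<in> borel_measurable M" "q \<in> borel_measurable M"
    unfolding w_def[abs_def] q_def[abs_def] by measurable
  have w0: "0 \<le> w x" and q0: "0 \<le> q x" for x
    using \<kappa> h by (auto simp: w_def q_def)
  have avg: "(u + u) * ennreal h = u" for u :: ennreal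
  proof -
    have "(u + u) * ennreal h = u * (ennreal h + ennreal h)"
      by (simp add: distrib_left distrib_right)
    also have "\<dots> = u" using h by (simp add: ennreal_plus[symmetric] del: ennreal_plus)
    finally show ?thesis .
  qed
  have sym: "(\<integral>\<^sup>+x. f x \<partial>M) = (\<integral>\<^sup>+x. (f x + f (\<tau> x)) * ennreal h \<partial>M)"
    if [measurable]: "f \<in> borel_measurable M" for f :: "'a \<Rightarrow> ennreal"
    by (simp add: nn_integral_multc nn_integral_add inv avg)
  have pt: "h * (Z x + Z (\<tau> x)) \<le> w x * q x" for x
  proof (rule power2_le_imp_le)
    have quarter: "(h * r)\<^sup>2 = h * (r\<^sup>2 / 2)" for r
      by (simp add: power_mult_distrib h)
    have "(Z x + Z (\<tau> x))\<^sup>2 \<le> 2 * ((Z x)\<^sup>2 + (Z (\<tau> x))\<^sup>2)"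
      using sum_squares_bound[of "Z x" "Z (\<tau> x)"] by (simp add: power2_sum)
    then have "(Z x + Z (\<tau> x))\<^sup>2 / 2 \<le> (w x)\<^sup>2 * ((Z x)\<^sup>2 + (Z (\<tau> x))\<^sup>2)"
      using gap[of x] \<kappa> by (auto simp: w_def)
    then have "h * ((Z x + Z (\<tau> x))\<^sup>2 / 2) \<le> h * ((w x)\<^sup>2 * ((Z x)\<^sup>2 + (Z (\<tau> x))\<^sup>2))"
      using h by (intro mult_left_mono)
    also have "\<dots> = (w x * q x)\<^sup>2"
      using h(1) by (simp add: q_def power_mult_distrib)
    finally show "(h * (Z x + Z (\<tau> x)))\<^sup>2 \<le> (w x * q x)\<^sup>2"
      unfolding quarter .
  qed (use w0 q0 in simp)
  have "(\<integral>\<^sup>+x. a x * ennreal (Z x) \<partial>M)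
      = (\<integral>\<^sup>+x. (a x * ennreal (Z x) + a x * ennreal (Z (\<tau> x))) * ennreal h \<partial>M)"
    by (subst sym) (simp_all add: a)
  also have "\<dots> \<le> (\<integral>\<^sup>+x. ennreal (w x) * (a x * ennreal (q x)) \<partial>M)"
  proof (intro nn_integral_mono)
    fix x
    have "(a x * ennreal (Z x) + a x * ennreal (Z (\<tau> x))) * ennreal h
        = a x * ennreal (h * (Z x + Z (\<tau> x)))"
    proof -
      have "ennreal (h * (Z x + Z (\<tau> x))) = ennreal h * (ennreal (Z x) + ennreal (Z (\<tau> x)))"
        using Z h by (subst ennreal_mult) (auto simp: ennreal_plus)
      then show ?thesis by (simp only: distrib_left distrib_right ac_simps)
    qed
    also have "\<dots> \<le> a x * ennreal (w x * q x)"
      by (intro mult_left_mono ennreal_leI pt) simp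
    also have "\<dots> = ennreal (w x) * (a x * ennreal (q x))"
      using w0 q0 by (simp add: ennreal_mult ac_simps)
    finally show "(a x * ennreal (Z x) + a x * ennreal (Z (\<tau> x))) * ennreal h
        \<le> ennreal (w x) * (a x * ennreal (q x))" .
  qed
  finally have "(\<integral>\<^sup>+x. a x * ennreal (Z x) \<partial>M)\<^sup>2
      \<le> (\<integral>\<^sup>+x. ennreal (w x) * (a x * ennreal (q x)) \<partial>M)\<^sup>2"
    by (intro power_mono) simp_all
  also have "\<dots> \<le> (\<integral>\<^sup>+x. (ennreal (w x))\<^sup>2 \<partial>M) * (\<integral>\<^sup>+x. (a x * ennreal (q x))\<^sup>2 \<partial>M)"
    by (rule Cauchy_Schwarz_nn_integral) measurable
  also have "(\<integral>\<^sup>+x. (ennreal (w x))\<^sup>2 \<partial>M) = ennreal (1 - \<kappa> * measure M B)"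
  proof -
    have "(\<integral>\<^sup>+x. (ennreal (w x))\<^sup>2 \<partial>M) = (\<integral>\<^sup>+x. ennreal (1 - \<kappa> * indicator B x) \<partial>M)"
      using \<kappa> w0 by (intro nn_integral_cong) (auto simp: ennreal_power w_def split: split_indicator)
    also have "\<dots> = ennreal (\<integral>x. 1 - \<kappa> * indicator B x \<partial>M)"
      using \<kappa> by (intro nn_integral_eq_integral AE_I2) (auto split: split_indicator simp: less_top[symmetric])
    also have "(\<integral>x. 1 - \<kappa> * indicator B x \<partial>M) = 1 - \<kappa> * measure M B"
      by (subst Bochner_Integration.integral_diff) (simp_all add: prob_space less_top[symmetric])
    finally show ?thesis .
  qed
  also have "(\<integral>\<^sup>+x. (a x * ennreal (q x))\<^sup>2 \<partial>M) = (\<integral>\<^sup>+x. (a x)\<^sup>2 * ennreal ((Z x)\<^sup>2) \<partial>M)"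
  proof -
    have "(a x * ennreal (q x))\<^sup>2
        = ((a x)\<^sup>2 * ennreal ((Z x)\<^sup>2) + (a (\<tau> x))\<^sup>2 * ennreal ((Z (\<tau> x))\<^sup>2)) * ennreal h" for x
    proof -
      have "(ennreal (q x))\<^sup>2 = ennreal (h * ((Z x)\<^sup>2 + (Z (\<tau> x))\<^sup>2))"
        using q0[of x] h by (simp add: ennreal_power q_def)
      also have "\<dots> = ennreal h * (ennreal ((Z x)\<^sup>2) + ennreal ((Z (\<tau> x))\<^sup>2))"
        using h by (subst ennreal_mult) (auto simp: ennreal_plus)
      finally show ?thesis
        by (simp only: a power_mult_distrib distrib_left distrib_right ac_simps)
    qed
    then show ?thesis
      by (subst (2) sym) simp_all
  qed
  finally show ?thesis .
qed

lemma det_perturbation: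
  fixes G H :: "real^2^2"
  assumes G: "\<And>i j. \<bar>G$i$j\<bar> \<le> 2" and H: "\<And>i j. \<bar>H$i$j\<bar> \<le> 2"
    and d: "\<And>i j. \<bar>G$i$j - H$i$j\<bar> \<le> s"
  shows "\<bar>det G - det H\<bar> \<le> 8 * s"
proof -
  have "det G - det H = G$1$1 * (G$2$2 - H$2$2) + H$2$2 * (G$1$1 - H$1$1)
      + (- G$1$2 * (G$2$1 - H$2$1) + - H$2$1 * (G$1$2 - H$1$2))"
    by (simp add: det_2 algebra_simps)
  also have "\<bar>\<dots>\<bar> \<le> 2 * s + 2 * s + (2 * s + 2 * s)"
    using G H d by (intro abs_triangle_ineq[THEN order_trans] add_mono)
      (auto simp: abs_mult intro!: mult_mono)
  finally show ?thesis by simp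
qed

lemma perturbed_entry_le:
  fixes A X :: "real^'n^'m"
  assumes A: "\<bar>A$i$j\<bar> \<le> 1" and \<epsilon>: "0 < \<epsilon>" "\<epsilon> < 1" and X: "\<bar>X$i$j\<bar> \<le> 1"
  shows "\<bar>(A + \<epsilon> *\<^sub>R X)$i$j\<bar> \<le> 2"
proof -
  have "\<epsilon> * \<bar>X$i$j\<bar> \<le> 1 * 1" using X \<epsilon> by (intro mult_mono) auto
  then have "\<bar>\<epsilon> * X$i$j\<bar> \<le> 1" using \<epsilon> by (simp add: abs_mult)
  then show ?thesis using A abs_triangle_ineq[of "A$i$j" "\<epsilon> * X$i$j"] by simp
qed

text \<open>Two boxes of noise between which \<open>\<bar>det (A + \<epsilon> X)\<bar>\<close> differs by a definite amount although the
image of \<open>x\<close> is the same. The centre \<open>C\<close> is a multiple of the identity, chosen such that the image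
\<open>y\<close> of the unit vector \<open>u\<close> along \<open>x\<close> is not too small. The matrix \<open>D\<close> is the rank one matrix that
kills \<open>u\<close> and maps its normal to a vector perpendicular to \<open>y\<close>. It shifts the determinant
linearly, by \<open>\<epsilon> \<bar>y\<bar> / 4\<close> in absolute value, and the sign of \<open>D\<close> is taken such that
\<open>\<bar>det\<bar>\<close> increases. The radius \<open>\<epsilon> / 512\<close> is small enough for the estimate at the centres to
survive on the whole boxes with half of its size.\<close>
lemma gap_configuration:
  fixes A :: "real^2^2" and x :: "real^2"
  assumes A: "\<And>i j. \<bar>A$i$j\<bar> \<le> 1" and \<epsilon>: "0 < \<epsilon>" "\<epsilon> < 1" and x: "x \<noteq> 0"
  obtains C D where
    "support_box (\<epsilon>/512) C" "support_box (\<epsilon>/512) (C + D)"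
    "entry_box (\<epsilon>/512) C \<inter> entry_box (\<epsilon>/512) (C + D) = {}"
    "D *v x = 0"
    "\<And>X. X \<in> entry_box (\<epsilon>/512) C \<Longrightarrow>
      \<epsilon>\<^sup>2 / 32 \<le> \<bar>\<bar>det (A + \<epsilon> *\<^sub>R (X + D))\<bar> - \<bar>det (A + \<epsilon> *\<^sub>R X)\<bar>\<bar>"
proof -
  define \<eta> where "\<eta> = \<epsilon> / 512"
  have \<eta>: "0 \<le> \<eta>" "\<eta> < 1/512" using \<epsilon> by (auto simp: \<eta>_def)
  define u where "u = x /\<^sub>R norm x"
  have u1: "norm u = 1" using x by (simp add: u_def)
  then have u2: "(u$1)\<^sup>2 + (u$2)\<^sup>2 = 1" by (simp add: norm_sq_vec2[symmetric])
  have ule: "\<bar>u$i\<bar> \<le> 1" for i using component_le_norm_cart[of u i] u1 by simp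
  \<comment> \<open>The images of \<open>u\<close> for the two signs of \<open>c\<close> differ by \<open>\<epsilon> u / 2\<close>, so one of them has norm at
    least \<open>\<epsilon> / 4\<close>.\<close>
  obtain c where c: "\<bar>c\<bar> = 1/4" and yc: "\<epsilon> / 4 \<le> norm ((A + \<epsilon> *\<^sub>R mat c) *v u)"
  proof -
    have mv: "mat c *v u = c *\<^sub>R u" for c
      by (simp add: matrix_vector_mult_def mat_def vec_eq_iff sum_2 forall_2)
    have "(A + \<epsilon> *\<^sub>R mat (1/4)) *v u - (A + \<epsilon> *\<^sub>R mat (-1/4)) *v u = (\<epsilon>/2) *\<^sub>R u"
      by (simp add: matrix_vector_mult_add_rdistrib scaleR_matrix_vector_assoc[symmetric] mv
          scaleR_left_distrib[symmetric] scaleR_diff_left[symmetric])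
    then have "\<epsilon> / 2 = norm ((A + \<epsilon> *\<^sub>R mat (1/4)) *v u - (A + \<epsilon> *\<^sub>R mat (-1/4)) *v u)"
      using u1 \<epsilon> by simp
    also have "\<dots> \<le> norm ((A + \<epsilon> *\<^sub>R mat (1/4)) *v u) + norm ((A + \<epsilon> *\<^sub>R mat (-1/4)) *v u)"
      by (rule norm_triangle_ineq4)
    finally have "\<epsilon>/4 \<le> norm ((A + \<epsilon> *\<^sub>R mat (1/4)) *v u) \<or> \<epsilon>/4 \<le> norm ((A + \<epsilon> *\<^sub>R mat (-1/4)) *v u)"
      by linarith
    then show thesis using that[of "1/4"] that[of "-1/4"] by auto
  qed
  define C :: "real^2^2" where "C = mat c"
  define G where "G = A + \<epsilon> *\<^sub>R C"
  define y where "y = G *v u"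
  have y: "\<epsilon> / 4 \<le> norm y" using yc by (simp add: y_def G_def C_def)
  then have y0: "0 < norm y" using \<epsilon> by linarith
  have yle: "\<bar>y$i\<bar> \<le> norm y" for i by (rule component_le_norm_cart)
  define s :: real where "s = (if 0 \<le> det G then 1/4 else -1/4) / norm y"
  define D where "D = mat2 (s * y$2 * u$2) (- s * y$2 * u$1) (- s * y$1 * u$2) (s * y$1 * u$1)"
  have Du: "D *v x = 0"
    by (simp add: vec_eq_iff forall_2 matrix_vector_mult_def sum_2 D_def u_def)
  have sy: "\<bar>s * y$i\<bar> \<le> 1/4" for i
    using yle[of i] y0 by (simp add: s_def abs_mult field_simps)
  have Dle: "\<bar>D$i$j\<bar> \<le> 1/4" for i j
  proof -
    have "\<bar>s * y$k * u$l\<bar> \<le> 1/4 * 1" for k l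
      unfolding abs_mult[of "s * y$k"] using sy ule by (intro mult_mono) auto
    then have "\<forall>i j. \<bar>D$i$j\<bar> \<le> 1/4" by (simp add: forall_2 D_def)
    then show ?thesis by blast
  qed
  have Cle: "\<bar>C$i$j\<bar> \<le> 1/4" for i j using c by (auto simp: C_def mat_def)
  have CDle: "\<bar>(C + D)$i$j\<bar> \<le> 1/2" for i j
    using Cle[of i j] Dle[of i j] abs_triangle_ineq[of "C$i$j" "D$i$j"] by simp
  have support_boxI: "support_box \<eta> K" if K: "\<And>i j. \<bar>K$i$j\<bar> \<le> 1/2" for K
    unfolding support_box_def
  proof (intro conjI allI)
    show "\<bar>K$i$j\<bar> + \<eta> \<le> 1" for i j using K[of i j] \<eta> by linarith
  qed (use \<eta> in simp)
  have Cin: "support_box \<eta> C"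
    by (rule support_boxI) (rule Cle[THEN order_trans], simp)
  have CDin: "support_box \<eta> (C + D)"
    by (rule support_boxI) (rule CDle)
  \<comment> \<open>The boxes are disjoint because \<open>D\<close> has Frobenius norm \<open>1/4\<close>, which exceeds their diameter.\<close>
  have "(norm D)\<^sup>2 = s\<^sup>2 * ((y$1)\<^sup>2 + (y$2)\<^sup>2) * ((u$1)\<^sup>2 + (u$2)\<^sup>2)"
    by (simp add: norm_sq_mat2 D_def power_mult_distrib algebra_simps)
  also have "\<dots> = s\<^sup>2 * (norm y)\<^sup>2" by (simp add: u2 norm_sq_vec2)
  also have "s\<^sup>2 = 1/16 / (norm y)\<^sup>2" by (simp add: s_def power_divide)
  also have "\<dots> * (norm y)\<^sup>2 = 1/16" using y0 by simp
  finally have nD: "(norm D)\<^sup>2 = 1/16" .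
  have disj: "entry_box \<eta> C \<inter> entry_box \<eta> (C + D) = {}"
  proof (rule ccontr)
    assume "entry_box \<eta> C \<inter> entry_box \<eta> (C + D) \<noteq> {}"
    then obtain X where X: "\<bar>X$i$j - C$i$j\<bar> \<le> \<eta>" "\<bar>X$i$j - (C + D)$i$j\<bar> \<le> \<eta>" for i j
      by (auto simp: entry_box_def)
    have "\<bar>D$i$j\<bar> \<le> 1/256" for i j using X[of i j] \<eta> by simp
    then have "(D$i$j)\<^sup>2 \<le> (1/256)\<^sup>2" for i j by (simp add: abs_le_square_iff[symmetric])
    then have "(norm D)\<^sup>2 \<le> 4 * (1/256)\<^sup>2"
      unfolding norm_sq_mat2 by (smt (verit))
    then show False using nD by (simp add: power2_eq_square)
  qed
  have det_shift: "det (G + \<epsilon> *\<^sub>R D) = det G + \<epsilon> * (s * (norm y)\<^sup>2)"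
  proof -
    have "det (G + \<epsilon> *\<^sub>R D) = det G + \<epsilon> * s * (y$1 * (G$1$1 * u$1 + G$1$2 * u$2)
        + y$2 * (G$2$1 * u$1 + G$2$2 * u$2))"
      by (simp add: det_2 D_def algebra_simps)
    also have "y$1 * (G$1$1 * u$1 + G$1$2 * u$2) + y$2 * (G$2$1 * u$1 + G$2$2 * u$2) = (norm y)\<^sup>2"
      unfolding norm_sq_vec2 by (simp add: power2_eq_square y_def matrix_vector_mult_def sum_2)
    finally show ?thesis by (simp add: mult.assoc)
  qed
  have center: "\<bar>det (G + \<epsilon> *\<^sub>R D)\<bar> = \<bar>det G\<bar> + \<epsilon> * norm y / 4"
  proof -
    have "0 \<le> \<epsilon> * norm y / 4" using \<epsilon> by simp
    moreover have "\<epsilon> * (s * (norm y)\<^sup>2) = (if 0 \<le> det G then \<epsilon> * norm y / 4 else - (\<epsilon> * norm y / 4))"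
      using y0 by (auto simp: s_def power2_eq_square)
    ultimately show ?thesis unfolding det_shift by (smt (verit))
  qed
  have "\<epsilon> * (\<epsilon> / 4) \<le> \<epsilon> * norm y" using y \<epsilon> by (intro mult_left_mono) auto
  then have big: "\<epsilon>\<^sup>2 / 16 \<le> \<bar>det (G + \<epsilon> *\<^sub>R D)\<bar> - \<bar>det G\<bar>"
    unfolding center by (simp add: power2_eq_square)
  note entries = perturbed_entry_le[OF A \<epsilon>]
  have gap: "\<epsilon>\<^sup>2 / 32 \<le> \<bar>\<bar>det (A + \<epsilon> *\<^sub>R (X + D))\<bar> - \<bar>det (A + \<epsilon> *\<^sub>R X)\<bar>\<bar>"
    if X: "X \<in> entry_box \<eta> C" for X
  proof -
    have XC: "\<bar>X$i$j - C$i$j\<bar> \<le> \<eta>" for i j using X by (auto simp: entry_box_def)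
    have X1: "\<bar>X$i$j\<bar> \<le> 1" and XD1: "\<bar>(X + D)$i$j\<bar> \<le> 1" for i j
      using XC[of i j] Cle[of i j] Dle[of i j] \<eta> by auto
    have C1: "\<bar>C$i$j\<bar> \<le> 1" and CD1: "\<bar>(C + D)$i$j\<bar> \<le> 1" for i j
      using Cle[of i j] CDle[of i j] by auto
    have dd: "\<bar>\<epsilon> * X$i$j - \<epsilon> * C$i$j\<bar> \<le> \<epsilon> * \<eta>" for i j
      unfolding right_diff_distrib[symmetric] abs_mult using XC[of i j] \<epsilon> by (simp add: mult_left_mono)
    have "\<bar>det (A + \<epsilon> *\<^sub>R X) - det (A + \<epsilon> *\<^sub>R C)\<bar> \<le> 8 * (\<epsilon> * \<eta>)"
      by (intro det_perturbation entries X1 C1) (use dd in simp)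
    moreover have "\<bar>det (A + \<epsilon> *\<^sub>R (X + D)) - det (A + \<epsilon> *\<^sub>R (C + D))\<bar> \<le> 8 * (\<epsilon> * \<eta>)"
      by (intro det_perturbation entries XD1 CD1) (use dd in \<open>simp add: algebra_simps\<close>)
    moreover have CG: "A + \<epsilon> *\<^sub>R (C + D) = G + \<epsilon> *\<^sub>R D" "A + \<epsilon> *\<^sub>R C = G"
      by (simp_all add: G_def algebra_simps)
    moreover have "8 * (\<epsilon> * \<eta>) + 8 * (\<epsilon> * \<eta>) = \<epsilon>\<^sup>2 / 32" by (simp add: \<eta>_def power2_eq_square)
    moreover have "e / 32 \<le> \<bar>\<bar>y\<bar> - \<bar>x\<bar>\<bar>"
      if "\<bar>x - a\<bar> \<le> t" "\<bar>y - b\<bar> \<le> t" "t + t = e / 32" "e / 16 \<le> \<bar>b\<bar> - \<bar>a\<bar>" for x y a b t e :: real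
      using that by linarith
    ultimately show ?thesis using big by (simp only: CG)
  qed
  show thesis
    by (rule that[of C D, folded \<eta>_def]) (use Cin CDin disj Du gap in auto)
qed

text \<open>The gap of the averaged operator, in its pointwise form. For fixed \<open>x\<close> the swap of the two
boxes leaves \<open>F (g X *v x)\<close> invariant and moves \<open>\<bar>det (g X)\<bar>\<close>, so that \<open>invariant_gap\<close>
applies with \<open>\<kappa> = \<epsilon>\<^bsup>4\<^esup> / 2\<^bsup>20\<^esup>\<close> and a box of measure \<open>(\<epsilon> / 512)\<^bsup>4\<^esup>\<close>.\<close>
lemma spectral_gap:
  fixes A :: "real^2^2" and x :: "real^2" and F :: "real^2 \<Rightarrow> ennreal"
  assumes A: "\<And>i j. \<bar>A$i$j\<bar> \<le> 1" and \<epsilon>: "0 < \<epsilon>" "\<epsilon> < 1" and x: "x \<noteq> 0"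
    and [measurable]: "F \<in> borel_measurable borel"
  defines "g \<equiv> \<lambda>X. A + \<epsilon> *\<^sub>R X"
  shows "(\<integral>\<^sup>+X. F (g X *v x) * ennreal (sqrt \<bar>det (g X)\<bar>) \<partial>uniform_mat2)\<^sup>2
    \<le> ennreal (1 - \<epsilon> ^ 8 / 2 ^ 56) * (\<integral>\<^sup>+X. (F (g X *v x))\<^sup>2 * ennreal \<bar>det (g X)\<bar> \<partial>uniform_mat2)"
proof -
  obtain C D where CD: "support_box (\<epsilon>/512) C" "support_box (\<epsilon>/512) (C + D)"
    "entry_box (\<epsilon>/512) C \<inter> entry_box (\<epsilon>/512) (C + D) = {}"
    and D: "D *v x = 0"
    and gap: "\<And>X. X \<in> entry_box (\<epsilon>/512) C \<Longrightarrow>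
      \<epsilon>\<^sup>2 / 32 \<le> \<bar>\<bar>det (A + \<epsilon> *\<^sub>R (X + D))\<bar> - \<bar>det (A + \<epsilon> *\<^sub>R X)\<bar>\<bar>"
    using gap_configuration[OF A \<epsilon> x] by blast
  let ?B = "entry_box (\<epsilon>/512) C" and ?\<tau> = "box_swap (\<epsilon>/512) C D"
  let ?Z = "\<lambda>X. sqrt \<bar>det (g X)\<bar>"
  define \<kappa> where "\<kappa> = \<epsilon> ^ 4 / 2 ^ 20"
  have [measurable]: "g \<in> borel_measurable borel" unfolding g_def by measurable
  have e4: "\<epsilon> ^ 4 \<le> 1" using \<epsilon> by (simp add: power_le_one)
  have \<kappa>: "0 \<le> \<kappa>" "\<kappa> \<le> 1" using \<epsilon> e4 by (auto simp: \<kappa>_def)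
  have gx: "g (?\<tau> X) *v x = g X *v x" for X
  proof -
    have "(A + \<epsilon> *\<^sub>R (X + D)) *v x = (A + \<epsilon> *\<^sub>R X) *v x" "(A + \<epsilon> *\<^sub>R (X - D)) *v x = (A + \<epsilon> *\<^sub>R X) *v x" for X
      using D by (simp_all add: matrix_vector_mult_add_rdistrib matrix_vector_mult_diff_rdistrib
          scaleR_matrix_vector_assoc[symmetric])
    then show ?thesis by (simp add: box_swap_def g_def)
  qed
  have det_le: "\<bar>det (A + \<epsilon> *\<^sub>R X)\<bar> \<le> 8" if X: "\<And>i j. \<bar>X$i$j\<bar> \<le> 1" for X
  proof -
    have 2: "\<bar>(A + \<epsilon> *\<^sub>R X)$i$j\<bar> \<le> 2" for i j
      by (rule perturbed_entry_le[OF A \<epsilon> X])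
    have "\<bar>a * d - b * c\<bar> \<le> 8" if "\<bar>a\<bar> \<le> 2" "\<bar>b\<bar> \<le> 2" "\<bar>c\<bar> \<le> 2" "\<bar>d\<bar> \<le> 2" for a b c d :: real
    proof -
      have "\<bar>a * d\<bar> \<le> 2 * 2" "\<bar>b * c\<bar> \<le> 2 * 2" unfolding abs_mult using that by (intro mult_mono; simp)+
      then show ?thesis by linarith
    qed
    then show ?thesis using 2 by (simp add: det_2)
  qed
  have gapZ: "(?Z X + ?Z (?\<tau> X))\<^sup>2 / 2 \<le> (1 - \<kappa>) * ((?Z X)\<^sup>2 + (?Z (?\<tau> X))\<^sup>2)" if X: "X \<in> ?B" for X
  proof -
    have \<tau>: "?\<tau> X = X + D" using X by (simp add: box_swap_def)
    have in1: "\<bar>Y$i$j\<bar> \<le> 1" if "Y \<in> entry_box (\<epsilon>/512) K" "support_box (\<epsilon>/512) K" for Y K i j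
    proof -
      have "\<bar>Y$i$j - K$i$j\<bar> \<le> \<epsilon>/512" "\<bar>K$i$j\<bar> + \<epsilon>/512 \<le> 1"
        using that by (auto simp: entry_box_def support_box_def)
      then show ?thesis by linarith
    qed
    have XD: "X + D \<in> entry_box (\<epsilon>/512) (C + D)" using X by (simp add: entry_box_def)
    define a b where "a = \<bar>det (g X)\<bar>" and "b = \<bar>det (g (X + D))\<bar>"
    have ab: "0 \<le> a" "a \<le> 8" "0 \<le> b" "b \<le> 8"
      using det_le[OF in1[OF X CD(1)]] det_le[OF in1[OF XD CD(2)]] by (auto simp: a_def b_def g_def)
    have "\<epsilon>\<^sup>2 / 32 \<le> \<bar>a - b\<bar>" using gap[OF X] by (simp add: a_def b_def g_def abs_minus_commute)
    then have "(\<epsilon>\<^sup>2 / 32)\<^sup>2 \<le> \<bar>a - b\<bar>\<^sup>2" by (intro power_mono) simp_all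
    then have ab2: "\<epsilon> ^ 4 / 1024 \<le> (a - b)\<^sup>2" by (simp add: power_divide power_mult[symmetric])
    \<comment> \<open>The gap between \<open>a\<close> and \<open>b\<close> becomes one between their square roots, as these are bounded.\<close>
    have fac: "(a - b)\<^sup>2 = (sqrt a - sqrt b)\<^sup>2 * (sqrt a + sqrt b)\<^sup>2"
      using ab by (simp add: power_mult_distrib[symmetric] algebra_simps)
    have sum: "(sqrt a + sqrt b)\<^sup>2 + (sqrt a - sqrt b)\<^sup>2 = 2 * (a + b)"
      using ab by (simp add: power2_sum power2_diff)
    have "(sqrt a + sqrt b)\<^sup>2 \<le> 2 * (a + b)" unfolding sum[symmetric] by simp
    also have "\<dots> \<le> 32" using ab by simp
    finally have "(sqrt a + sqrt b)\<^sup>2 \<le> 32" .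
    then have "(a - b)\<^sup>2 \<le> (sqrt a - sqrt b)\<^sup>2 * 32"
      unfolding fac by (intro mult_left_mono) simp_all
    then have "\<epsilon> ^ 4 / 2 ^ 15 \<le> (sqrt a - sqrt b)\<^sup>2" using ab2 by simp
    moreover have "2 * \<kappa> * (a + b) \<le> 2 * \<kappa> * 16" using ab \<kappa> by (intro mult_left_mono) auto
    then have "2 * \<kappa> * (a + b) \<le> \<epsilon> ^ 4 / 2 ^ 15" by (simp add: \<kappa>_def)
    ultimately have "(sqrt a + sqrt b)\<^sup>2 / 2 \<le> (1 - \<kappa>) * (a + b)"
      using sum by (simp add: algebra_simps)
    then show ?thesis using ab by (simp add: \<tau> a_def b_def)
  qed
  have "(\<integral>\<^sup>+X. F (g X *v x) * ennreal (?Z X) \<partial>uniform_mat2)\<^sup>2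
    \<le> ennreal (1 - \<kappa> * measure uniform_mat2 ?B) *
      (\<integral>\<^sup>+X. (F (g X *v x))\<^sup>2 * ennreal ((?Z X)\<^sup>2) \<partial>uniform_mat2)"
  proof (rule invariant_gap[where \<tau> = ?\<tau> and \<kappa> = \<kappa> and B = ?B and Z = ?Z
        and a = "\<lambda>X. F (g X *v x)"])
    show "?\<tau> \<in> uniform_mat2 \<rightarrow>\<^sub>M uniform_mat2" by measurable
    show "(\<integral>\<^sup>+X. f (?\<tau> X) \<partial>uniform_mat2) = (\<integral>\<^sup>+X. f X \<partial>uniform_mat2)"
      if "f \<in> borel_measurable uniform_mat2" for f
      using that CD by (intro nn_integral_box_swap) simp_all
  qed (use gapZ \<kappa> prob_space_uniform_mat2 gx in simp_all)
  also have "measure uniform_mat2 ?B = (\<epsilon>/512) ^ 4"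
    using emeasure_entry_box[OF CD(1)] \<epsilon> by (simp add: measure_def)
  also have "\<kappa> * (\<epsilon>/512) ^ 4 = \<epsilon> ^ 8 / 2 ^ 56"
    by (simp add: \<kappa>_def power_divide)
  finally show ?thesis by simp
qed

section \<open>The isometric action on homogeneous functions of the plane\<close>

lemma linear_change_of_variables:
  fixes B :: "real^'n::{finite,wellorder}^'n::{finite,wellorder}" and f :: "real^'n::{finite,wellorder} \<Rightarrow> ennreal"
  assumes B: "det B \<noteq> 0" and [measurable]: "f \<in> borel_measurable borel"
  shows "ennreal \<bar>det B\<bar> * (\<integral>\<^sup>+x. f (B *v x) \<partial>lborel) = (\<integral>\<^sup>+x. f x \<partial>lborel)"
proof -
  obtain B' where B': "B ** B' = mat 1" "B' ** B = mat 1"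
    using B by (metis invertible_det_nz invertible_def)
  have det': "\<bar>det B\<bar> * \<bar>det B'\<bar> = 1"
    by (metis B'(1) det_mul det_I abs_mult abs_one)
  have [measurable]: "(*v) B \<in> borel_measurable borel"
    by (intro borel_measurable_continuous_onI linear_continuous_on linear_linear[THEN iffD2]
        matrix_vector_mul_linear) 
  let ?M = "density (distr lborel borel ((*v) B)) (\<lambda>_. ennreal \<bar>det B\<bar>)"
  have "lborel = ?M"
  proof (rule lborel_eqI)
    fix l u :: "real^'n::{finite,wellorder}"
    assume lu: "\<And>b. b \<in> Basis \<Longrightarrow> l \<bullet> b \<le> u \<bullet> b"
    have pre: "(*v) B -` box l u = (*v) B' ` box l u"
    proof (intro set_eqI iffI)
      fix x assume "x \<in> (*v) B -` box l u"
      moreover have "x = B' *v (B *v x)" by (simp add: matrix_vector_mul_assoc B')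
      ultimately show "x \<in> (*v) B' ` box l u" by blast
    qed (auto simp: matrix_vector_mul_assoc B')
    have lm: "box l u \<in> lmeasurable" by simp
    have "(*v) B' ` box l u \<in> lmeasurable"
      by (rule measurable_linear_image[OF matrix_vector_mul_linear lm])
    then have "emeasure lebesgue ((*v) B' ` box l u) = ennreal (measure lebesgue ((*v) B' ` box l u))"
      by (simp add: emeasure_eq_measure2)
    also have "measure lebesgue ((*v) B' ` box l u) = \<bar>det B'\<bar> * measure lebesgue (box l u)"
      by (subst measure_linear_image[OF matrix_vector_mul_linear lm]) simp
    finally have *: "emeasure lborel ((*v) B -` box l u) = ennreal (\<bar>det B'\<bar> * measure lborel (box l u))"
      using measurable_sets_borel[of "(*v) B" borel "box l u"]
      unfolding pre[symmetric] by (simp add: emeasure_completion)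
    have "emeasure ?M (box l u) = ennreal \<bar>det B\<bar> * emeasure lborel ((*v) B -` box l u)"
      by (simp add: emeasure_density nn_integral_cmult emeasure_distr)
    also have "\<dots> = ennreal ((\<bar>det B\<bar> * \<bar>det B'\<bar>) * measure lborel (box l u))"
      unfolding * by (simp add: ennreal_mult[symmetric] mult.assoc)
    also have "\<dots> = ennreal (\<Prod>b\<in>Basis. (u - l) \<bullet> b)"
      unfolding det' using lu by (simp add: measure_lborel_box_eq)
    finally show "emeasure ?M (box l u) = ennreal (\<Prod>b\<in>Basis. (u - l) \<bullet> b)" .
  qed simp
  then have "(\<integral>\<^sup>+x. f x \<partial>lborel) = (\<integral>\<^sup>+x. f x \<partial>?M)" by simp
  also have "\<dots> = ennreal \<bar>det B\<bar> * (\<integral>\<^sup>+x. f (B *v x) \<partial>lborel)"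
    by (simp add: nn_integral_density nn_integral_distr nn_integral_cmult)
  finally show ?thesis ..
qed

text \<open>The annulus is taken with respect to an arbitrary gauge \<open>N\<close>, because a linear map turns the
round annulus into an elliptic one.\<close>
definition annulus :: "(real^2 \<Rightarrow> real) \<Rightarrow> (real^2) set" where
  "annulus N = {x. 1 \<le> N x \<and> N x < 2}"

lemma measurable_annulus [measurable]:
  assumes [measurable]: "N \<in> borel_measurable borel"
  shows "annulus N \<in> sets borel"
proof -
  have "annulus N = {x \<in> space borel. 1 \<le> N x \<and> N x < 2}" by (simp add: annulus_def)
  also have "\<dots> \<in> sets borel" by measurable
  finally show ?thesis .
qed

lemma nn_integral_scale_plane:
  fixes f :: "real^2 \<Rightarrow> ennreal"
  assumes [measurable]: "f \<in> borel_measurable borel" and c: "0 < c"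
  shows "ennreal (c\<^sup>2) * (\<integral>\<^sup>+x. f (c *\<^sub>R x) \<partial>lborel) = (\<integral>\<^sup>+x. f x \<partial>lborel)"
proof -
  have "mat c *v x = c *\<^sub>R x" for x :: "real^2"
    by (simp add: matrix_vector_mult_def mat_def vec_eq_iff sum_2 forall_2)
  moreover have "det (mat c :: real^2^2) = c\<^sup>2" by (simp add: det_2 mat_def power2_eq_square)
  ultimately show ?thesis
    using linear_change_of_variables[of "mat c :: real^2^2" f] c by simp
qed

text \<open>The dyadic dilates of the annulus partition the plane without the origin.\<close>
lemma sum_dyadic_indicator:
  fixes r :: real
  assumes "0 < r"
  shows "(\<integral>\<^sup>+k. indicator {1..<2} (2 powi k * r) \<partial>count_space (UNIV :: int set)) = 1"
proof -
  define m where "m = - \<lfloor>log 2 r\<rfloor>"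
  have "(2 powi k * r \<in> {1..<2}) \<longleftrightarrow> k = m" for k :: int
  proof -
    have "2 powi k * r = 2 powr (real_of_int k + log 2 r)"
      using assms by (simp add: powr_add powr_real_of_int')
    then have "2 powi k * r \<in> {1..<2} \<longleftrightarrow> 2 powr 0 \<le> 2 powr (real_of_int k + log 2 r)
        \<and> 2 powr (real_of_int k + log 2 r) < 2 powr 1"
      by simp
    also have "\<dots> \<longleftrightarrow> 0 \<le> real_of_int k + log 2 r \<and> real_of_int k + log 2 r < 1"
      by (subst powr_le_cancel_iff, simp, subst powr_less_cancel_iff, simp_all)
    also have "\<dots> \<longleftrightarrow> k = m" unfolding m_def by linarith
    finally show ?thesis .
  qed
  then have "(\<lambda>k. indicator {1..<2} (2 powi k * r) :: ennreal) = indicator {m}"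
    by (auto simp: fun_eq_iff split: split_indicator)
  then show ?thesis by (simp add: one_ennreal_def)
qed

text \<open>The measure \<open>G dx\<close> is invariant under dilations, and both annuli are fundamental domains
for dilation by powers of \<open>2\<close>. Cutting each of them along the dilates of the other and moving the
pieces back identifies the two integrals. This replaces integration in polar coordinates.\<close>
lemma annulus_independence:
  fixes G :: "real^2 \<Rightarrow> ennreal"
  assumes [measurable]: "G \<in> borel_measurable borel" "N \<in> borel_measurable borel" "N' \<in> borel_measurable borel"
    and hom: "\<And>c x. 0 < c \<Longrightarrow> ennreal (c\<^sup>2) * G (c *\<^sub>R x) = G x"
    and N: "\<And>c x. 0 < c \<Longrightarrow> N (c *\<^sub>R x) = c * N x" "\<And>x. x \<noteq> 0 \<Longrightarrow> 0 < N x"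
    and N': "\<And>c x. 0 < c \<Longrightarrow> N' (c *\<^sub>R x) = c * N' x" "\<And>x. x \<noteq> 0 \<Longrightarrow> 0 < N' x"
  shows "(\<integral>\<^sup>+x. indicator (annulus N) x * G x \<partial>lborel) = (\<integral>\<^sup>+x. indicator (annulus N') x * G x \<partial>lborel)"
proof -
  let ?Z = "count_space (UNIV :: int set)"
  define T where "T k = (\<integral>\<^sup>+x. indicator {1..<2} (2 powi k * N' x) * (indicator {1..<2} (N x) * G x) \<partial>lborel)" for k :: int
  have ind: "indicator (annulus K) x = (indicator {1..<2} (K x) :: ennreal)" for K x
    by (auto simp: annulus_def split: split_indicator)
  have spread: "(\<integral>\<^sup>+x. indicator {1..<2} (K x) * G x \<partial>lborel)
      = (\<integral>\<^sup>+k. (\<integral>\<^sup>+x. indicator {1..<2} (2 powi k * K' x) * (indicator {1..<2} (K x) * G x) \<partial>lborel) \<partial>?Z)"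
    if [measurable]: "K \<in> borel_measurable borel" "K' \<in> borel_measurable borel"
      and K': "\<And>x. x \<noteq> 0 \<Longrightarrow> 0 < K' x" for K K' :: "real^2 \<Rightarrow> real"
  proof -
    have ae: "AE x in lborel. (x :: real^2) \<noteq> 0"
      by (rule AE_lborel_singleton)
    have "(\<integral>\<^sup>+x. indicator {1..<2} (K x) * G x \<partial>lborel)
      = (\<integral>\<^sup>+x. (\<integral>\<^sup>+k. indicator {1..<2} (2 powi k * K' x) * (indicator {1..<2} (K x) * G x) \<partial>?Z) \<partial>lborel)"
      by (rule nn_integral_cong_AE, use ae in eventually_elim)
        (simp add: nn_integral_multc sum_dyadic_indicator K')
    also have "\<dots> = (\<integral>\<^sup>+k. (\<integral>\<^sup>+x. indicator {1..<2} (2 powi k * K' x) * (indicator {1..<2} (K x) * G x) \<partial>lborel) \<partial>?Z)"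
      by (rule nn_integral_count_space_nn_integral) simp_all
    finally show ?thesis .
  qed
  have T': "(\<integral>\<^sup>+x. indicator {1..<2} (2 powi k * N x) * (indicator {1..<2} (N' x) * G x) \<partial>lborel) = T (- k)" for k
  proof -
    have c: "0 < (2 :: real) powi k" by simp
    have "T (- k) = ennreal ((2 powi k)\<^sup>2) * (\<integral>\<^sup>+x. indicator {1..<2} (2 powi (-k) * N' (2 powi k *\<^sub>R x))
        * (indicator {1..<2} (N (2 powi k *\<^sub>R x)) * G (2 powi k *\<^sub>R x)) \<partial>lborel)"
      unfolding T_def by (subst nn_integral_scale_plane[OF _ c, symmetric]) simp_all
    also have "\<dots> = (\<integral>\<^sup>+x. ennreal ((2 powi k)\<^sup>2) * (indicator {1..<2} (2 powi (-k) * N' (2 powi k *\<^sub>R x))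
        * (indicator {1..<2} (N (2 powi k *\<^sub>R x)) * G (2 powi k *\<^sub>R x))) \<partial>lborel)"
      by (simp add: nn_integral_cmult)
    also have "\<dots> = (\<integral>\<^sup>+x. indicator {1..<2} (2 powi k * N x) * (indicator {1..<2} (N' x) * G x) \<partial>lborel)"
    proof (rule nn_integral_cong)
      fix x
      have "2 powi (-k) * N' (2 powi k *\<^sub>R x) = N' x"
        using N'(1)[OF c] by (simp add: power_int_minus field_simps)
      then show "ennreal ((2 powi k)\<^sup>2) * (indicator {1..<2} (2 powi (-k) * N' (2 powi k *\<^sub>R x))
        * (indicator {1..<2} (N (2 powi k *\<^sub>R x)) * G (2 powi k *\<^sub>R x)))
        = indicator {1..<2} (2 powi k * N x) * (indicator {1..<2} (N' x) * G x)"
        unfolding N(1)[OF c] by (subst hom[OF c, of x, symmetric]) (simp only: ac_simps)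
    qed
    finally show ?thesis ..
  qed
  have "(\<integral>\<^sup>+x. indicator (annulus N') x * G x \<partial>lborel) = (\<integral>\<^sup>+k. T (- k) \<partial>?Z)"
    unfolding ind by (subst spread[of N' N]) (simp_all add: N T')
  also have "\<dots> = (\<integral>\<^sup>+k. T k \<partial>?Z)"
    by (rule nn_integral_bij_count_space) (rule bij_uminus)
  also have "\<dots> = (\<integral>\<^sup>+x. indicator (annulus N) x * G x \<partial>lborel)"
    unfolding ind T_def by (subst spread[of N N']) (simp_all add: N')
  finally show ?thesis ..
qed

text \<open>The change of variables \<open>y = B x\<close> leads to an annulus for the gauge \<open>norm (B\<^sup>-\<^sup>1 y)\<close>, which may
be replaced by the round one. For singular \<open>B\<close> the left-hand side vanishes.\<close>
lemma linear_action_isometric: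
  fixes G :: "real^2 \<Rightarrow> ennreal"
  assumes [measurable]: "G \<in> borel_measurable borel"
    and hom: "\<And>c x. 0 < c \<Longrightarrow> ennreal (c\<^sup>2) * G (c *\<^sub>R x) = G x"
  shows "(\<integral>\<^sup>+x. indicator (annulus norm) x * (G (B *v x) * ennreal \<bar>det B\<bar>) \<partial>lborel)
    \<le> (\<integral>\<^sup>+x. indicator (annulus norm) x * G x \<partial>lborel)"
proof (cases "det B = 0")
  case False
  then obtain B' where B': "B ** B' = mat 1" "B' ** B = mat 1"
    by (metis invertible_det_nz invertible_def)
  have B'0: "B' *v x \<noteq> 0" if "x \<noteq> 0" for x
  proof
    assume "B' *v x = 0"
    then have "B *v (B' *v x) = 0" by simp
    then show False using that by (simp add: matrix_vector_mul_assoc B')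
  qed
  have "(\<integral>\<^sup>+x. indicator (annulus norm) x * (G (B *v x) * ennreal \<bar>det B\<bar>) \<partial>lborel)
      = ennreal \<bar>det B\<bar> * (\<integral>\<^sup>+x. indicator (annulus (\<lambda>y. norm (B' *v y))) (B *v x) * G (B *v x) \<partial>lborel)"
    by (subst nn_integral_cmult[symmetric])
      (auto intro!: nn_integral_cong simp: annulus_def matrix_vector_mul_assoc B' ac_simps split: split_indicator)
  also have "\<dots> = (\<integral>\<^sup>+x. indicator (annulus (\<lambda>y. norm (B' *v y))) x * G x \<partial>lborel)"
    by (rule linear_change_of_variables[OF False, of "\<lambda>x. indicator (annulus (\<lambda>y. norm (B' *v y))) x * G x"])
      measurable
  also have "\<dots> = (\<integral>\<^sup>+x. indicator (annulus norm) x * G x \<partial>lborel)"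
    using hom by (intro annulus_independence) (auto simp: matrix_vector_mult_scaleR B'0)
  finally show ?thesis by simp
qed simp

section \<open>Inverse moments of determinants and geometric bounds along trajectories\<close>

text \<open>The inverse square root is dominated by a dyadic staircase: the value \<open>2\<^bsup>k+1\<^esup>\<close> is needed only
within distance \<open>4\<^bsup>-k\<^esup>\<close> of the singularity, an event of probability at most \<open>4\<^bsup>-k\<^esup>\<close>, uniformly in
the position \<open>-c\<close> of the singularity.\<close>
lemma expectation_inverse_sqrt_uniform:
  "(\<integral>\<^sup>+d. inverse (ennreal (sqrt \<bar>d + c\<bar>)) \<partial>uniform_pm1) \<le> 5"
proof -
  interpret U: prob_space uniform_pm1 by (rule prob_space_uniform_pm1)
  let ?S = "\<lambda>k. {d. \<bar>d + c\<bar> \<le> (1/4) ^ k}"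
  have meas [measurable]: "?S k \<in> sets borel" for k
    by simp
  have pt: "inverse (ennreal (sqrt \<bar>d + c\<bar>)) \<le> 1 + (\<Sum>k. ennreal (2 ^ Suc k) * indicator (?S k) d)"
    if d: "d \<noteq> - c" for d
  proof (cases "1 \<le> \<bar>d + c\<bar>")
    case True
    then have "inverse (ennreal (sqrt \<bar>d + c\<bar>)) \<le> 1"
      by (subst inverse_ennreal) (auto simp: inverse_le_1_iff)
    then show ?thesis by (rule add_increasing2[rotated]) simp
  next
    case False
    define y where "y = \<bar>d + c\<bar>"
    have y: "0 < y" "y < 1" using d False by (auto simp: y_def)
    define m where "m = (LEAST m. (1/4 :: real) ^ m < y)"
    have ex: "\<exists>m. (1/4 :: real) ^ m < y" using y by (intro real_arch_pow_inv) auto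
    have m: "(1/4) ^ m < y" unfolding m_def by (rule LeastI_ex[OF ex])
    then have "m \<noteq> 0" using y by (cases m) auto
    then obtain k where k: "m = Suc k" using not0_implies_Suc by blast
    have "\<not> (1/4) ^ k < y" using not_less_Least[of k "\<lambda>m. (1/4 :: real) ^ m < y"] k by (simp add: m_def)
    then have dS: "d \<in> ?S k" by (simp add: y_def)
    have "(1/2) ^ Suc k = sqrt ((1/4) ^ Suc k)"
      by (rule real_sqrt_unique[symmetric]) (simp_all add: power2_eq_square power_mult_distrib[symmetric])
    also have "\<dots> \<le> sqrt y" using m k by simp
    finally have "inverse (sqrt y) \<le> inverse ((1/2) ^ Suc k)"
      by (intro le_imp_inverse_le) simp_all
    also have "\<dots> = 2 ^ Suc k" by (simp add: power_one_over)
    finally have "inverse (ennreal (sqrt y)) \<le> ennreal (2 ^ Suc k)"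
      using y by (simp add: inverse_ennreal ennreal_leI)
    also have "\<dots> = (\<Sum>k\<in>{k}. ennreal (2 ^ Suc k) * indicator (?S k) d)" using dS by simp
    also have "\<dots> \<le> (\<Sum>k. ennreal (2 ^ Suc k) * indicator (?S k) d)"
      by (rule sum_le_suminf) auto
    finally show ?thesis unfolding y_def by (rule add_increasing[rotated]) simp
  qed
  have mass: "ennreal (2 ^ Suc k) * emeasure uniform_pm1 (?S k) \<le> ennreal (2 * (1/2) ^ k)" for k
  proof -
    have "emeasure uniform_pm1 (?S k) = emeasure lborel ({-1..1} \<inter> ?S k) / 2"
      by (subst emeasure_uniform_measure) simp_all
    also have "\<dots> \<le> emeasure lborel {- c - (1/4) ^ k..- c + (1/4) ^ k} / 2"
      by (intro divide_right_mono_ennreal emeasure_mono) auto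
    also have "\<dots> = ennreal ((1/4) ^ k)"
      by (simp add: divide_ennreal ennreal_numeral[symmetric] del: ennreal_numeral)
    finally have "ennreal (2 ^ Suc k) * emeasure uniform_pm1 (?S k) \<le> ennreal (2 ^ Suc k) * ennreal ((1/4) ^ k)"
      by (rule mult_left_mono) simp
    also have "\<dots> = ennreal (2 * (2 * (1/4)) ^ k)"
      by (subst ennreal_mult[symmetric]) (auto simp: power_mult_distrib[symmetric])
    finally show ?thesis by simp
  qed
  have ae: "AE d in uniform_pm1. d \<noteq> - c"
    by (rule AE_uniform_measureI) (use AE_lborel_singleton[of "-c"] in auto)
  have "(\<integral>\<^sup>+d. inverse (ennreal (sqrt \<bar>d + c\<bar>)) \<partial>uniform_pm1)
      \<le> (\<integral>\<^sup>+d. 1 + (\<Sum>k. ennreal (2 ^ Suc k) * indicator (?S k) d) \<partial>uniform_pm1)"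
    by (rule nn_integral_mono_AE) (use ae in eventually_elim, rule pt)
  also have "\<dots> = 1 + (\<Sum>k. ennreal (2 ^ Suc k) * emeasure uniform_pm1 (?S k))"
    by (subst nn_integral_add, simp, simp, subst nn_integral_suminf)
      (simp_all add: nn_integral_cmult U.emeasure_space_1[simplified])
  also have "\<dots> \<le> 1 + (\<Sum>k. ennreal (2 * (1/2) ^ k))"
    by (intro add_left_mono suminf_le mass) auto
  also have "(\<Sum>k. ennreal (2 * (1/2) ^ k)) = ennreal (\<Sum>k. 2 * (1/2) ^ k)"
    by (intro suminf_ennreal2) (auto intro!: summable_mult summable_geometric)
  also have "(\<Sum>k. 2 * (1/2 :: real) ^ k) = 4"
    by (subst suminf_mult) (simp_all add: suminf_geometric summable_geometric)
  finally show ?thesis by simp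
qed

lemma expectation_inverse_sqrt_affine:
  "(\<integral>\<^sup>+d. inverse (ennreal (sqrt \<bar>p + s * d\<bar>)) \<partial>uniform_pm1) \<le> 5 * inverse (ennreal (sqrt \<bar>s\<bar>))"
proof (cases "s = 0")
  case False
  have "inverse (ennreal (sqrt \<bar>p + s * d\<bar>))
      = inverse (ennreal (sqrt \<bar>s\<bar>)) * inverse (ennreal (sqrt \<bar>d + p / s\<bar>))" for d
  proof -
    have "p + s * d = s * (d + p / s)" using False by (simp add: field_simps)
    then have "ennreal (sqrt \<bar>p + s * d\<bar>) = ennreal (sqrt \<bar>s\<bar>) * ennreal (sqrt \<bar>d + p / s\<bar>)"
      by (simp only: abs_mult real_sqrt_mult ennreal_mult real_sqrt_ge_zero abs_ge_zero)
    then show ?thesis using False by (simp add: ennreal_inverse_mult)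
  qed
  then have "(\<integral>\<^sup>+d. inverse (ennreal (sqrt \<bar>p + s * d\<bar>)) \<partial>uniform_pm1)
      = inverse (ennreal (sqrt \<bar>s\<bar>)) * (\<integral>\<^sup>+d. inverse (ennreal (sqrt \<bar>d + p / s\<bar>)) \<partial>uniform_pm1)"
    by (simp add: nn_integral_cmult)
  also have "\<dots> \<le> inverse (ennreal (sqrt \<bar>s\<bar>)) * 5"
    by (intro mult_left_mono expectation_inverse_sqrt_uniform) simp
  finally show ?thesis by (simp add: mult.commute)
qed (simp add: ennreal_mult_top)

text \<open>Extended values are essential: singular matrices get the value \<open>\<infinity>\<close>, so that a finite
expectation implies almost sure invertibility.\<close>
definition inv_sqrt_det :: "real^2^2 \<Rightarrow> ennreal" where
  "inv_sqrt_det M = inverse (ennreal (sqrt \<bar>det M\<bar>))"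

lemma measurable_inv_sqrt_det [measurable]:
  "f \<in> borel_measurable M \<Longrightarrow> (\<lambda>x. inv_sqrt_det (f x)) \<in> borel_measurable M"
  unfolding inv_sqrt_det_def by measurable

lemma inv_sqrt_det_mult: "inv_sqrt_det (M ** N) = inv_sqrt_det M * inv_sqrt_det N"
proof -
  have "inverse (ennreal (a * b)) = inverse (ennreal a) * inverse (ennreal b)" if "0 \<le> a" "0 \<le> b" for a b
    using that by (cases "a = 0 \<or> b = 0")
      (auto simp: ennreal_mult ennreal_inverse_mult ennreal_top_mult ennreal_mult_top)
  then show ?thesis
    by (simp add: inv_sqrt_det_def det_mul abs_mult real_sqrt_mult)
qed

text \<open>The determinant is affine in the last entry, with a slope that is affine in the first entry, so
the one-dimensional bound applies twice.\<close>
lemma expectation_inv_sqrt_det: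
  fixes A :: "real^2^2"
  assumes \<epsilon>: "0 < \<epsilon>"
  shows "(\<integral>\<^sup>+X. inv_sqrt_det (A + \<epsilon> *\<^sub>R X) \<partial>uniform_mat2) \<le> ennreal (25 / \<epsilon>)"
proof -
  interpret U: prob_space uniform_pm1 by (rule prob_space_uniform_pm1)
  let ?s = "\<lambda>a. \<epsilon> * A$1$1 + \<epsilon>\<^sup>2 * a"
  have inner: "(\<integral>\<^sup>+d. inv_sqrt_det (A + \<epsilon> *\<^sub>R mat2 a b c d) \<partial>uniform_pm1)
      \<le> 5 * inverse (ennreal (sqrt \<bar>?s a\<bar>))" for a b c
  proof -
    have "det (A + \<epsilon> *\<^sub>R mat2 a b c d) = ((A$1$1 + \<epsilon> * a) * A$2$2 - (A$1$2 + \<epsilon> * b) * (A$2$1 + \<epsilon> * c)) + ?s a * d" for d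
      by (simp add: det_2 power2_eq_square algebra_simps)
    then show ?thesis
      unfolding inv_sqrt_det_def by (simp only: expectation_inverse_sqrt_affine)
  qed
  have "(\<integral>\<^sup>+X. inv_sqrt_det (A + \<epsilon> *\<^sub>R X) \<partial>uniform_mat2)
      \<le> (\<integral>\<^sup>+a. \<integral>\<^sup>+b. \<integral>\<^sup>+c. 5 * inverse (ennreal (sqrt \<bar>?s a\<bar>)) \<partial>uniform_pm1 \<partial>uniform_pm1 \<partial>uniform_pm1)"
    by (subst nn_integral_uniform_mat2, simp) (intro nn_integral_mono inner)
  also have "\<dots> = (\<integral>\<^sup>+a. 5 * inverse (ennreal (sqrt \<bar>?s a\<bar>)) \<partial>uniform_pm1)"
    by (simp add: U.emeasure_space_1[simplified])
  also have "\<dots> = 5 * (\<integral>\<^sup>+a. inverse (ennreal (sqrt \<bar>?s a\<bar>)) \<partial>uniform_pm1)"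
    by (rule nn_integral_cmult) measurable
  also have "\<dots> \<le> 5 * (5 * inverse (ennreal (sqrt \<bar>\<epsilon>\<^sup>2\<bar>)))"
    by (intro mult_left_mono expectation_inverse_sqrt_affine) simp
  also have "\<dots> = ennreal 5 * (ennreal 5 * ennreal (1 / \<epsilon>))"
    using \<epsilon> by (simp add: inverse_ennreal inverse_eq_divide)
  also have "\<dots> = ennreal (25 / \<epsilon>)"
    using \<epsilon> by (simp add: ennreal_mult[symmetric] del: ennreal_numeral)
  finally show ?thesis .
qed

text \<open>The sum of \<open>Y n / \<rho>\<^bsup>n\<^esup>\<close> has finite expectation, hence is almost surely finite, and its terms
tend to zero.\<close>
lemma (in prob_space) AE_eventually_le_geometric:
  fixes Y :: "nat \<Rightarrow> 'a \<Rightarrow> real"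
  assumes [measurable]: "\<And>n. Y n \<in> borel_measurable M"
    and Y0: "\<And>n \<omega>. 0 \<le> Y n \<omega>"
    and E: "\<And>n. (\<integral>\<^sup>+\<omega>. ennreal (Y n \<omega>) \<partial>M) \<le> ennreal (C * \<theta> ^ n)"
    and C: "0 \<le> C" and \<theta>: "0 \<le> \<theta>" "\<theta> < \<rho>"
  shows "AE \<omega> in M. eventually (\<lambda>n. Y n \<omega> \<le> \<rho> ^ n) sequentially"
proof -
  have \<rho>: "0 < \<rho>" using \<theta> by linarith
  have "(\<integral>\<^sup>+\<omega>. (\<Sum>n. ennreal (Y n \<omega> / \<rho> ^ n)) \<partial>M) = (\<Sum>n. \<integral>\<^sup>+\<omega>. ennreal (Y n \<omega> / \<rho> ^ n) \<partial>M)"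
    by (rule nn_integral_suminf) measurable
  also have "\<dots> \<le> (\<Sum>n. ennreal (C * (\<theta> / \<rho>) ^ n))"
  proof (intro suminf_le)
    fix n
    have "(\<integral>\<^sup>+\<omega>. ennreal (Y n \<omega> / \<rho> ^ n) \<partial>M) = ennreal (1 / \<rho> ^ n) * (\<integral>\<^sup>+\<omega>. ennreal (Y n \<omega>) \<partial>M)"
      using \<rho> Y0 by (subst nn_integral_cmult[symmetric]) (auto simp: ennreal_mult[symmetric])
    also have "\<dots> \<le> ennreal (1 / \<rho> ^ n) * ennreal (C * \<theta> ^ n)"
      by (intro mult_left_mono E) simp
    also have "\<dots> = ennreal (C * (\<theta> / \<rho>) ^ n)"
      using \<rho> \<theta> C by (simp add: ennreal_mult[symmetric] power_divide)
    finally show "(\<integral>\<^sup>+\<omega>. ennreal (Y n \<omega> / \<rho> ^ n) \<partial>M) \<le> ennreal (C * (\<theta> / \<rho>) ^ n)" .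
  qed auto
  also have "\<dots> = ennreal (\<Sum>n. C * (\<theta> / \<rho>) ^ n)"
    using \<theta> \<rho> C by (intro suminf_ennreal2) (auto intro!: summable_mult summable_geometric)
  also have "\<dots> < \<infinity>" by simp
  finally have "AE \<omega> in M. (\<Sum>n. ennreal (Y n \<omega> / \<rho> ^ n)) \<noteq> \<infinity>"
    by (intro nn_integral_PInf_AE) auto
  then show ?thesis
  proof eventually_elim
    case (elim \<omega>)
    then have "summable (\<lambda>n. Y n \<omega> / \<rho> ^ n)"
      using Y0 \<rho> by (intro summable_suminf_not_top) auto
    then have "(\<lambda>n. Y n \<omega> / \<rho> ^ n) \<longlonglongrightarrow> 0" by (rule summable_LIMSEQ_zero)
    then have "eventually (\<lambda>n. Y n \<omega> / \<rho> ^ n < 1) sequentially"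
      by (rule order_tendstoD) simp
    then show ?case
      using \<rho> by (auto elim!: eventually_mono simp: field_simps)
  qed
qed

section \<open>Products of random matrices\<close>

lemma perturbed_product_cong:
  assumes "\<And>i. i \<in> {1..n} \<Longrightarrow> X i = Y i"
  shows "perturbed_product A X \<epsilon> n = perturbed_product A Y \<epsilon> n"
  using assms by (induction n) auto

lemma perturbed_product_split:
  fixes A :: "nat \<Rightarrow> real^'n^'n"
  shows "perturbed_product A X \<epsilon> (n + k)
    = perturbed_product (\<lambda>i. A (i + k)) (\<lambda>i. X (i + k)) \<epsilon> n ** perturbed_product A X \<epsilon> k"
  by (induction n) (simp_all add: matrix_mul_assoc)

text \<open>The average of the isometric action over one random factor.\<close>
definition transfer_op :: "real^2^2 \<Rightarrow> real \<Rightarrow> (real^2 \<Rightarrow> ennreal) \<Rightarrow> real^2 \<Rightarrow> ennreal" where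
  "transfer_op A \<epsilon> F x =
    (\<integral>\<^sup>+X. F ((A + \<epsilon> *\<^sub>R X) *v x) * ennreal (sqrt \<bar>det (A + \<epsilon> *\<^sub>R X)\<bar>) \<partial>uniform_mat2)"

lemma measurable_transfer_op [measurable]:
  assumes [measurable]: "F \<in> borel_measurable borel"
  shows "transfer_op A \<epsilon> F \<in> borel_measurable borel"
proof -
  interpret prob_space uniform_mat2 by (rule prob_space_uniform_mat2)
  show ?thesis unfolding transfer_op_def[abs_def] by measurable
qed

lemma transfer_op_homogeneous:
  assumes [measurable]: "F \<in> borel_measurable borel"
    and hom: "\<And>c x. 0 < c \<Longrightarrow> ennreal c * F (c *\<^sub>R x) = F x" and c: "0 < c"
  shows "ennreal c * transfer_op A \<epsilon> F (c *\<^sub>R x) = transfer_op A \<epsilon> F x"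
  unfolding transfer_op_def
  by (subst nn_integral_cmult[symmetric])
    (simp_all add: matrix_vector_mult_scaleR mult.assoc[symmetric] hom c)

text \<open>Integrate the pointwise gap over the annulus and use that each single matrix acts without
increasing the norm.\<close>
lemma transfer_op_contraction:
  fixes F :: "real^2 \<Rightarrow> ennreal"
  assumes A: "\<And>i j. \<bar>A$i$j\<bar> \<le> 1" and \<epsilon>: "0 < \<epsilon>" "\<epsilon> < 1"
    and [measurable]: "F \<in> borel_measurable borel"
    and hom: "\<And>c x. 0 < c \<Longrightarrow> ennreal c * F (c *\<^sub>R x) = F x"
  shows "(\<integral>\<^sup>+x. indicator (annulus norm) x * (transfer_op A \<epsilon> F x)\<^sup>2 \<partial>lborel)
    \<le> ennreal (1 - \<epsilon> ^ 8 / 2 ^ 56) * (\<integral>\<^sup>+x. indicator (annulus norm) x * (F x)\<^sup>2 \<partial>lborel)"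
proof -
  interpret prob_space uniform_mat2 by (rule prob_space_uniform_mat2)
  interpret pair_sigma_finite uniform_mat2 "lborel :: (real^2) measure" ..
  define q where "q = ennreal (1 - \<epsilon> ^ 8 / 2 ^ 56)"
  let ?g = "\<lambda>X. A + \<epsilon> *\<^sub>R X"
  let ?I = "indicator (annulus norm) :: real^2 \<Rightarrow> ennreal"
  have hom2: "ennreal (c\<^sup>2) * (F (c *\<^sub>R x))\<^sup>2 = (F x)\<^sup>2" if "0 < c" for c x
    using that by (subst hom[OF that, of x, symmetric]) (simp add: power_mult_distrib ennreal_power)
  have "(\<integral>\<^sup>+x. ?I x * (transfer_op A \<epsilon> F x)\<^sup>2 \<partial>lborel)
      \<le> (\<integral>\<^sup>+x. ?I x * (q * (\<integral>\<^sup>+X. (F (?g X *v x))\<^sup>2 * ennreal \<bar>det (?g X)\<bar> \<partial>uniform_mat2)) \<partial>lborel)"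
  proof (intro nn_integral_mono)
    fix x :: "real^2"
    show "?I x * (transfer_op A \<epsilon> F x)\<^sup>2
        \<le> ?I x * (q * (\<integral>\<^sup>+X. (F (?g X *v x))\<^sup>2 * ennreal \<bar>det (?g X)\<bar> \<partial>uniform_mat2))"
    proof (cases "x = 0")
      case False
      then show ?thesis
        unfolding transfer_op_def q_def by (intro mult_left_mono spectral_gap[OF A \<epsilon>]) simp_all
    qed (simp add: annulus_def)
  qed
  also have "\<dots> = q * (\<integral>\<^sup>+x. (\<integral>\<^sup>+X. ?I x * ((F (?g X *v x))\<^sup>2 * ennreal \<bar>det (?g X)\<bar>) \<partial>uniform_mat2) \<partial>lborel)"
    by (simp add: nn_integral_cmult mult.left_commute[of _ q])
  also have "(\<integral>\<^sup>+x. (\<integral>\<^sup>+X. ?I x * ((F (?g X *v x))\<^sup>2 * ennreal \<bar>det (?g X)\<bar>) \<partial>uniform_mat2) \<partial>lborel)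
      = (\<integral>\<^sup>+X. (\<integral>\<^sup>+x. ?I x * ((F (?g X *v x))\<^sup>2 * ennreal \<bar>det (?g X)\<bar>) \<partial>lborel) \<partial>uniform_mat2)"
    by (rule Fubini') measurable
  also have "\<dots> \<le> (\<integral>\<^sup>+X. (\<integral>\<^sup>+x. ?I x * (F x)\<^sup>2 \<partial>lborel) \<partial>uniform_mat2)"
    by (intro nn_integral_mono linear_action_isometric hom2) measurable
  also have "\<dots> = (\<integral>\<^sup>+x. ?I x * (F x)\<^sup>2 \<partial>lborel)"
    by (simp add: emeasure_space_1)
  finally show ?thesis by (simp add: q_def mult_left_mono)
qed

locale perturbed_matrices = prob_space P
  for P :: "'w measure" +
  fixes \<Xi> :: "nat \<Rightarrow> 'w \<Rightarrow> real^2^2" and A :: "nat \<Rightarrow> real^2^2" and \<epsilon> :: real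
  assumes noise: "independent_uniform_matrices P \<Xi>"
    and A_onorm: "\<And>n. 1 \<le> n \<Longrightarrow> onorm ((*v) (A n)) \<le> 1"
    and \<epsilon>: "0 < \<epsilon>" "\<epsilon> < 1"
begin

text \<open>The square of the contraction factor of the averaged operators.\<close>
definition gap_factor :: real where "gap_factor = 1 - \<epsilon> ^ 8 / 2 ^ 56"

definition cocycle :: "nat \<Rightarrow> 'w \<Rightarrow> real^2^2" where
  "cocycle n \<omega> = perturbed_product A (\<lambda>k. \<Xi> k \<omega>) \<epsilon> n"

definition factor :: "nat \<Rightarrow> 'w \<Rightarrow> real^2^2" where
  "factor n \<omega> = A n + \<epsilon> *\<^sub>R \<Xi> n \<omega>"

lemma cocycle_0: "cocycle 0 \<omega> = mat 1" and cocycle_Suc: "cocycle (Suc n) \<omega> = factor (Suc n) \<omega> ** cocycle n \<omega>"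
  by (simp_all add: cocycle_def factor_def)

lemma A_entry_le: "1 \<le> n \<Longrightarrow> \<bar>A n $ i $ j\<bar> \<le> 1"
  using matrix_component_le_onorm[of "A n" i j] A_onorm[of n] by linarith

lemma measurable_\<Xi>: "1 \<le> n \<Longrightarrow> \<Xi> n \<in> borel_measurable P"
  and distr_\<Xi>: "1 \<le> n \<Longrightarrow> distr P borel (\<Xi> n) = uniform_mat2"
  using noise distr_uniform_mat2[of P "\<Xi> n"] unfolding independent_uniform_matrices_def by auto

lemma measurable_cocycle [measurable]: "cocycle n \<in> borel_measurable P"
  unfolding cocycle_def[abs_def] by (rule measurable_perturbed_product) (auto intro: measurable_\<Xi>)

lemma AE_\<Xi>_le: "1 \<le> n \<Longrightarrow> AE \<omega> in P. \<forall>i j. \<bar>\<Xi> n \<omega> $ i $ j\<bar> \<le> 1"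
proof -
  assume n: "1 \<le> n"
  note [measurable] = measurable_\<Xi>[OF n]
  have "AE \<omega> in P. \<bar>\<Xi> n \<omega> $ i $ j\<bar> \<le> 1" for i j
  proof -
    have eq: "distr P lborel (\<lambda>\<omega>. \<Xi> n \<omega> $ i $ j) = uniform_pm1"
      using noise n unfolding independent_uniform_matrices_def by blast
    have "AE x in distr P lborel (\<lambda>\<omega>. \<Xi> n \<omega> $ i $ j). \<bar>x\<bar> \<le> 1"
      unfolding eq by (rule AE_uniform_measureI) auto
    then show ?thesis by (subst (asm) AE_distr_iff) simp_all
  qed
  then show ?thesis by (simp add: forall_2)
qed

text \<open>The noise of step \<open>n + 1\<close> is independent of the product of the first \<open>n\<close> factors, which is a
function of the earlier noise. So the new factor may be averaged first, with the product
frozen.\<close>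
lemma nn_integral_next_factor:
  assumes [measurable]: "case_prod f \<in> borel_measurable (borel \<Otimes>\<^sub>M borel)"
  shows "(\<integral>\<^sup>+\<omega>. f (cocycle n \<omega>) (\<Xi> (Suc n) \<omega>) \<partial>P) = (\<integral>\<^sup>+\<omega>. (\<integral>\<^sup>+X. f (cocycle n \<omega>) X \<partial>uniform_mat2) \<partial>P)"
proof -
  interpret X: prob_space uniform_mat2 by (rule prob_space_uniform_mat2)
  note [measurable] = measurable_\<Xi>[of "Suc n", simplified]
  let ?past = "\<lambda>x. perturbed_product A x \<epsilon> n :: real^2^2" and ?next = "\<lambda>x. x (Suc n) :: real^2^2"
  have ind: "indep_vars (\<lambda>_. borel) \<Xi> {1..}"
    using noise by (simp add: independent_uniform_matrices_def)
  have "indep_var (PiM {1..n} (\<lambda>_. borel)) (\<lambda>\<omega>. restrict (\<lambda>i. \<Xi> i \<omega>) {1..n})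
      (PiM {Suc n} (\<lambda>_. borel)) (\<lambda>\<omega>. restrict (\<lambda>i. \<Xi> i \<omega>) {Suc n})"
    by (rule indep_var_restrict[OF ind]) auto
  then have "indep_var borel (?past \<circ> (\<lambda>\<omega>. restrict (\<lambda>i. \<Xi> i \<omega>) {1..n}))
      borel (?next \<circ> (\<lambda>\<omega>. restrict (\<lambda>i. \<Xi> i \<omega>) {Suc n}))"
  proof (rule indep_var_compose)
    show "?past \<in> borel_measurable (PiM {1..n} (\<lambda>_. borel))"
      by (rule measurable_perturbed_product) simp
  qed simp
  also have "?past \<circ> (\<lambda>\<omega>. restrict (\<lambda>i. \<Xi> i \<omega>) {1..n}) = cocycle n"
    unfolding cocycle_def[abs_def] comp_def by (intro ext perturbed_product_cong) simp
  also have "?next \<circ> (\<lambda>\<omega>. restrict (\<lambda>i. \<Xi> i \<omega>) {Suc n}) = \<Xi> (Suc n)"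
    by (simp add: fun_eq_iff)
  finally have joint: "distr P borel (cocycle n) \<Otimes>\<^sub>M uniform_mat2
      = distr P (borel \<Otimes>\<^sub>M borel) (\<lambda>\<omega>. (cocycle n \<omega>, \<Xi> (Suc n) \<omega>))"
    by (simp add: indep_var_distribution_eq distr_\<Xi>)
  have "(\<integral>\<^sup>+\<omega>. f (cocycle n \<omega>) (\<Xi> (Suc n) \<omega>) \<partial>P)
      = (\<integral>\<^sup>+z. case_prod f z \<partial>distr P (borel \<Otimes>\<^sub>M borel) (\<lambda>\<omega>. (cocycle n \<omega>, \<Xi> (Suc n) \<omega>)))"
    by (subst nn_integral_distr) simp_all
  also have "\<dots> = (\<integral>\<^sup>+m. \<integral>\<^sup>+X. f m X \<partial>uniform_mat2 \<partial>distr P borel (cocycle n))"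
    unfolding joint[symmetric] by (subst X.nn_integral_fst[symmetric]) simp_all
  also have "\<dots> = (\<integral>\<^sup>+\<omega>. (\<integral>\<^sup>+X. f (cocycle n \<omega>) X \<partial>uniform_mat2) \<partial>P)"
    by (subst nn_integral_distr) simp_all
  finally show ?thesis .
qed

text \<open>Averaging over the last factor replaces \<open>F\<close> by its transform under the transfer operator and
shortens the product by one factor, so the contractions accumulate.\<close>
lemma L2_decay:
  assumes [measurable]: "F \<in> borel_measurable borel"
    and hom: "\<And>c x. 0 < c \<Longrightarrow> ennreal c * F (c *\<^sub>R x) = F x"
  shows "(\<integral>\<^sup>+x. indicator (annulus norm) x *
        (\<integral>\<^sup>+\<omega>. F (cocycle n \<omega> *v x) * ennreal (sqrt \<bar>det (cocycle n \<omega>)\<bar>) \<partial>P)\<^sup>2 \<partial>lborel)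
    \<le> ennreal gap_factor ^ n * (\<integral>\<^sup>+x. indicator (annulus norm) x * (F x)\<^sup>2 \<partial>lborel)"
  using assms
proof (induction n arbitrary: F)
  case 0
  then show ?case by (simp add: cocycle_0 emeasure_space_1)
next
  case (Suc n)
  note [measurable] = Suc.prems(1)
  let ?T = "transfer_op (A (Suc n)) \<epsilon> F"
  have "(\<integral>\<^sup>+\<omega>. F (cocycle (Suc n) \<omega> *v x) * ennreal (sqrt \<bar>det (cocycle (Suc n) \<omega>)\<bar>) \<partial>P)
      = (\<integral>\<^sup>+\<omega>. ?T (cocycle n \<omega> *v x) * ennreal (sqrt \<bar>det (cocycle n \<omega>)\<bar>) \<partial>P)" for x
  proof -
    let ?f = "\<lambda>m X. F ((A (Suc n) + \<epsilon> *\<^sub>R X) *v (m *v x)) *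
      ennreal (sqrt \<bar>det (A (Suc n) + \<epsilon> *\<^sub>R X)\<bar>) * ennreal (sqrt \<bar>det m\<bar>)"
    have "(\<integral>\<^sup>+\<omega>. F (cocycle (Suc n) \<omega> *v x) * ennreal (sqrt \<bar>det (cocycle (Suc n) \<omega>)\<bar>) \<partial>P)
        = (\<integral>\<^sup>+\<omega>. ?f (cocycle n \<omega>) (\<Xi> (Suc n) \<omega>) \<partial>P)"
      by (simp add: cocycle_Suc factor_def det_mul abs_mult real_sqrt_mult ennreal_mult mult.assoc
          matrix_vector_mul_assoc)
    also have "\<dots> = (\<integral>\<^sup>+\<omega>. (\<integral>\<^sup>+X. ?f (cocycle n \<omega>) X \<partial>uniform_mat2) \<partial>P)"
      by (rule nn_integral_next_factor) measurable
    also have "\<dots> = (\<integral>\<^sup>+\<omega>. ?T (cocycle n \<omega> *v x) * ennreal (sqrt \<bar>det (cocycle n \<omega>)\<bar>) \<partial>P)"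
      unfolding transfer_op_def by (subst nn_integral_multc) simp_all
    finally show ?thesis .
  qed
  then have "(\<integral>\<^sup>+x. indicator (annulus norm) x *
        (\<integral>\<^sup>+\<omega>. F (cocycle (Suc n) \<omega> *v x) * ennreal (sqrt \<bar>det (cocycle (Suc n) \<omega>)\<bar>) \<partial>P)\<^sup>2 \<partial>lborel)
      \<le> ennreal gap_factor ^ n * (\<integral>\<^sup>+x. indicator (annulus norm) x * (?T x)\<^sup>2 \<partial>lborel)"
    using Suc.IH[of ?T] transfer_op_homogeneous[OF Suc.prems(1) Suc.prems(2)] by simp
  also have "\<dots> \<le> ennreal gap_factor ^ n *
      (ennreal gap_factor * (\<integral>\<^sup>+x. indicator (annulus norm) x * (F x)\<^sup>2 \<partial>lborel))"
    unfolding gap_factor_def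
    by (intro mult_left_mono transfer_op_contraction A_entry_le \<epsilon> Suc.prems) simp_all
  finally show ?case by (simp add: mult.assoc mult.commute mult.left_commute)
qed

lemma gap_factor_bounds: "0 < gap_factor" "gap_factor < 1"
proof -
  have "0 < \<epsilon> ^ 8" "\<epsilon> ^ 8 \<le> 1" using \<epsilon> by (auto simp: power_le_one)
  then show "0 < gap_factor" "gap_factor < 1" by (auto simp: gap_factor_def)
qed

text \<open>For \<open>F x = 1 / norm x\<close> the decay estimate controls this expectation, since
\<open>norm (M x) \<le> 2 norm M\<close> on the annulus.\<close>
lemma expectation_sqrt_det_over_norm:
  "(\<integral>\<^sup>+\<omega>. ennreal (sqrt \<bar>det (cocycle n \<omega>)\<bar> / norm (cocycle n \<omega>)) \<partial>P) \<le> ennreal (2 * sqrt gap_factor ^ n)"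
proof -
  define E where "E = (\<integral>\<^sup>+\<omega>. ennreal (sqrt \<bar>det (cocycle n \<omega>)\<bar> / norm (cocycle n \<omega>)) \<partial>P)"
  define F :: "real^2 \<Rightarrow> ennreal" where "F x = ennreal (1 / norm x)" for x
  define a where "a = emeasure lborel (annulus (norm :: real^2 \<Rightarrow> real))"
  have [measurable]: "F \<in> borel_measurable borel" unfolding F_def[abs_def] by measurable
  have hom: "ennreal c * F (c *\<^sub>R x) = F x" if "0 < c" for c x
    using that by (simp add: F_def ennreal_mult[symmetric])
  have a_fin: "a \<noteq> top"
  proof -
    have "a \<le> emeasure lborel (ball (0 :: real^2) 2)"
      unfolding a_def by (intro emeasure_mono) (auto simp: annulus_def)
    then show ?thesis using emeasure_lborel_ball_finite[of "0 :: real^2" 2] by (auto simp: top_unique)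
  qed
  have a_pos: "a \<noteq> 0"
  proof -
    let ?c = "(3/2) *\<^sub>R axis 1 1 :: real^2"
    have nc: "norm ?c = 3/2" by (simp add: norm_axis_1)
    have "ball ?c (1/2) \<subseteq> annulus norm"
    proof
      fix y assume "y \<in> ball ?c (1/2)"
      then have "norm (?c - y) < 1/2" by (simp add: dist_norm)
      then show "y \<in> annulus norm"
        using nc norm_triangle_ineq2[of ?c y] norm_triangle_ineq3[of ?c y]
        by (auto simp: annulus_def)
    qed
    then have "emeasure lborel (ball ?c (1/2)) \<le> a"
      unfolding a_def by (intro emeasure_mono) simp_all
    moreover have "emeasure lborel (ball ?c (1/2)) \<noteq> 0"
      using content_ball_pos[of "1/2" ?c] by (auto simp: measure_def)
    ultimately show ?thesis by auto
  qed
  have lower: "ennreal (1/2) * E \<le> (\<integral>\<^sup>+\<omega>. F (cocycle n \<omega> *v x) * ennreal (sqrt \<bar>det (cocycle n \<omega>)\<bar>) \<partial>P)"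
    if x: "x \<in> annulus norm" for x
  proof -
    have "ennreal (1/2) * E = (\<integral>\<^sup>+\<omega>. ennreal (1/2) * ennreal (sqrt \<bar>det (cocycle n \<omega>)\<bar> / norm (cocycle n \<omega>)) \<partial>P)"
      unfolding E_def by (rule nn_integral_cmult[symmetric]) measurable
    also have "\<dots> \<le> (\<integral>\<^sup>+\<omega>. F (cocycle n \<omega> *v x) * ennreal (sqrt \<bar>det (cocycle n \<omega>)\<bar>) \<partial>P)"
    proof (intro nn_integral_mono)
      fix \<omega>
      have x12: "1 \<le> norm x" "norm x < 2" using x by (auto simp: annulus_def)
      show "ennreal (1/2) * ennreal (sqrt \<bar>det (cocycle n \<omega>)\<bar> / norm (cocycle n \<omega>))
          \<le> F (cocycle n \<omega> *v x) * ennreal (sqrt \<bar>det (cocycle n \<omega>)\<bar>)"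
      proof (cases "det (cocycle n \<omega>) = 0")
        case False
        then have pos: "0 < norm (cocycle n \<omega>)" by (rule norm_pos_of_det_nz)
        have "cocycle n \<omega> *v x \<noteq> 0"
          using False x12 by (metis invertible_det_nz matrix_left_invertible_ker
              invertible_left_inverse norm_zero not_one_le_zero)
        then have y: "0 < norm (cocycle n \<omega> *v x)" by simp
        have "norm (cocycle n \<omega> *v x) \<le> norm (cocycle n \<omega>) * norm x" by (rule norm_matrix_vector_mult_le)
        also have "\<dots> \<le> norm (cocycle n \<omega>) * 2" using x12 pos by simp
        finally have "1 / (norm (cocycle n \<omega>) * 2) \<le> 1 / norm (cocycle n \<omega> *v x)"
          using y pos by (intro divide_left_mono mult_pos_pos) simp_all
        then have "1 / (norm (cocycle n \<omega>) * 2) * sqrt \<bar>det (cocycle n \<omega>)\<bar> \<le> 1 / norm (cocycle n \<omega> *v x) * sqrt \<bar>det (cocycle n \<omega>)\<bar>"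
          by (intro mult_right_mono) auto
        then show ?thesis
          unfolding F_def by (subst (1 2) ennreal_mult[symmetric]) (auto simp: field_simps intro!: ennreal_leI)
      qed simp
    qed
    finally show ?thesis .
  qed
  have "a * (ennreal (1/2) * E)\<^sup>2 = (\<integral>\<^sup>+x. indicator (annulus norm) x * (ennreal (1/2) * E)\<^sup>2 \<partial>(lborel :: (real^2) measure))"
    unfolding a_def by (subst nn_integral_multc) simp_all
  also have "\<dots> \<le> (\<integral>\<^sup>+x. indicator (annulus norm) x *
        (\<integral>\<^sup>+\<omega>. F (cocycle n \<omega> *v x) * ennreal (sqrt \<bar>det (cocycle n \<omega>)\<bar>) \<partial>P)\<^sup>2 \<partial>lborel)"
  proof (rule nn_integral_mono)
    fix x :: "real^2"
    show "indicator (annulus norm) x * (ennreal (1/2) * E)\<^sup>2 \<le> indicator (annulus norm) x *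
        (\<integral>\<^sup>+\<omega>. F (cocycle n \<omega> *v x) * ennreal (sqrt \<bar>det (cocycle n \<omega>)\<bar>) \<partial>P)\<^sup>2"
    proof (cases "x \<in> annulus norm")
      case True
      then show ?thesis by (intro mult_left_mono power_mono lower) simp_all
    qed simp
  qed
  also have "\<dots> \<le> ennreal gap_factor ^ n * (\<integral>\<^sup>+x. indicator (annulus norm) x * (F x)\<^sup>2 \<partial>lborel)"
    using hom by (intro L2_decay) simp_all
  also have "\<dots> \<le> ennreal gap_factor ^ n * a"
  proof (rule mult_left_mono)
    have "(1 / norm x)\<^sup>2 \<le> 1" if "1 \<le> norm x" for x :: "real^2"
      using that by (simp add: power_divide divide_le_eq_1 one_le_power order_less_le_trans[OF zero_less_one])
    then have "(\<integral>\<^sup>+x. indicator (annulus norm) x * (F x)\<^sup>2 \<partial>lborel)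
        \<le> (\<integral>\<^sup>+x. indicator (annulus norm) x \<partial>(lborel :: (real^2) measure))"
      by (intro nn_integral_mono) (auto split: split_indicator simp: F_def annulus_def ennreal_power)
    then show "(\<integral>\<^sup>+x. indicator (annulus norm) x * (F x)\<^sup>2 \<partial>lborel) \<le> a"
      by (simp add: a_def)
  qed simp
  finally have "a * (ennreal (1/2) * E)\<^sup>2 \<le> a * ennreal gap_factor ^ n"
    by (simp only: mult.commute)
  then have le: "(ennreal (1/2) * E)\<^sup>2 \<le> ennreal gap_factor ^ n"
    using a_pos a_fin by (simp add: ennreal_mult_le_mult_iff)
  show ?thesis
  proof (cases E)
    case (real r)
    have "(ennreal (1/2) * E)\<^sup>2 = ennreal ((1/2 * r)\<^sup>2)"
      using real by (subst real(2)) (simp only: ennreal_mult[symmetric] ennreal_power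
          zero_le_divide_1_iff zero_le_numeral mult_nonneg_nonneg)
    then have "(1/2 * r)\<^sup>2 \<le> gap_factor ^ n"
      using le gap_factor_bounds by (simp add: ennreal_power)
    also have "\<dots> = (sqrt gap_factor ^ n)\<^sup>2"
    proof -
      have "(sqrt gap_factor ^ n)\<^sup>2 = (sqrt gap_factor)\<^sup>2 ^ n"
        by (simp only: power_mult[symmetric] mult.commute)
      then show ?thesis using gap_factor_bounds by simp
    qed
    finally have "(1/2 * r)\<^sup>2 \<le> (sqrt gap_factor ^ n)\<^sup>2" .
    then have "1/2 * r \<le> sqrt gap_factor ^ n"
      by (rule power2_le_imp_le) (use gap_factor_bounds in simp)
    then show ?thesis unfolding E_def[symmetric] real(2) by (intro ennreal_leI) simp
  next
    case top
    then have "ennreal (1/2) * E = \<infinity>" by (simp add: ennreal_mult_top)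
    then have "(ennreal (1/2) * E)\<^sup>2 = \<infinity>" by (simp only:) (simp add: power2_eq_square)
    moreover have "ennreal gap_factor ^ n < \<infinity>" using gap_factor_bounds by (simp add: ennreal_power)
    ultimately show ?thesis using le by simp
  qed
qed

lemma expectation_inv_sqrt_det_product:
  "(\<integral>\<^sup>+\<omega>. inv_sqrt_det (cocycle n \<omega>) \<partial>P) \<le> ennreal ((25 / \<epsilon>) ^ n)"
proof (induction n)
  case 0
  then show ?case by (simp add: cocycle_0 inv_sqrt_det_def emeasure_space_1)
next
  case (Suc n)
  have "(\<integral>\<^sup>+\<omega>. inv_sqrt_det (cocycle (Suc n) \<omega>) \<partial>P)
      = (\<integral>\<^sup>+\<omega>. inv_sqrt_det (A (Suc n) + \<epsilon> *\<^sub>R \<Xi> (Suc n) \<omega>) * inv_sqrt_det (cocycle n \<omega>) \<partial>P)"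
    by (simp add: cocycle_Suc factor_def inv_sqrt_det_mult)
  also have "\<dots> = (\<integral>\<^sup>+\<omega>. (\<integral>\<^sup>+X. inv_sqrt_det (A (Suc n) + \<epsilon> *\<^sub>R X) * inv_sqrt_det (cocycle n \<omega>) \<partial>uniform_mat2) \<partial>P)"
    by (rule nn_integral_next_factor) measurable
  also have "\<dots> = (\<integral>\<^sup>+X. inv_sqrt_det (A (Suc n) + \<epsilon> *\<^sub>R X) \<partial>uniform_mat2) * (\<integral>\<^sup>+\<omega>. inv_sqrt_det (cocycle n \<omega>) \<partial>P)"
    by (simp add: nn_integral_multc nn_integral_cmult)
  also have "\<dots> \<le> ennreal (25 / \<epsilon>) * ennreal ((25 / \<epsilon>) ^ n)"
    using \<epsilon> by (intro mult_mono expectation_inv_sqrt_det Suc.IH) simp_all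
  also have "\<dots> = ennreal ((25 / \<epsilon>) ^ Suc n)"
    using \<epsilon> by (simp add: ennreal_mult[symmetric])
  finally show ?case .
qed

text \<open>A singular product would make the inverse square root of its determinant infinite.\<close>
lemma AE_det_nz: "AE \<omega> in P. \<forall>n. det (cocycle n \<omega>) \<noteq> 0"
  unfolding AE_all_countable
proof
  fix n
  have "(\<integral>\<^sup>+\<omega>. inv_sqrt_det (cocycle n \<omega>) \<partial>P) \<noteq> \<infinity>"
    using expectation_inv_sqrt_det_product[of n] by (auto simp: top_unique)
  then have "AE \<omega> in P. inv_sqrt_det (cocycle n \<omega>) \<noteq> \<infinity>"
    by (intro nn_integral_PInf_AE) simp_all
  then show "AE \<omega> in P. det (cocycle n \<omega>) \<noteq> 0"
    by eventually_elim (auto simp: inv_sqrt_det_def)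
qed

end

text \<open>Bounded changes are invisible after division by \<open>n + k\<close>. The shift \<open>k\<close> keeps the
denominator equal to the length of the whole product when the first \<open>k\<close> factors are
removed.\<close>
section \<open>The growth rate is almost surely constant\<close>

lemma liminf_average_cong:
  fixes a b :: "nat \<Rightarrow> real"
  assumes "\<And>n. \<bar>a n - b n\<bar> \<le> C"
  shows "liminf (\<lambda>n. ereal (1 / real (n + k) * a n)) = liminf (\<lambda>n. ereal (1 / real (n + k) * b n))"
proof -
  have "(\<lambda>n. 1 / real (n + k) * (a n - b n)) \<longlonglongrightarrow> 0"
  proof (rule Lim_null_comparison)
    show "eventually (\<lambda>n. norm (1 / real (n + k) * (a n - b n)) \<le> C * (1 / real (n + k))) sequentially"
      using assms by (auto intro!: always_eventually simp: abs_mult divide_right_mono)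
    have "(\<lambda>n. 1 / real (n + k)) \<longlonglongrightarrow> 0"
      using LIMSEQ_ignore_initial_segment[OF lim_1_over_n[where 'a = real], of k] by simp
    then show "(\<lambda>n. C * (1 / real (n + k))) \<longlonglongrightarrow> 0"
      by (intro tendsto_mult_right_zero)
  qed
  then have "(\<lambda>n. ereal (1 / real (n + k) * (a n - b n))) \<longlonglongrightarrow> 0"
    by (simp add: zero_ereal_def)
  then have "liminf (\<lambda>n. ereal (1 / real (n + k) * (a n - b n)) + ereal (1 / real (n + k) * b n))
      = 0 + liminf (\<lambda>n. ereal (1 / real (n + k) * b n))"
    by (rule ereal_liminf_lim_add) simp
  then show ?thesis by (simp add: algebra_simps add_divide_distrib[symmetric])
qed

text \<open>The distribution function of \<open>R\<close> takes only the values \<open>0\<close> and \<open>1\<close>, and the bounds place its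
jump in \<open>[a, b]\<close>.\<close>
lemma (in prob_space) AE_constant_of_zero_one:
  fixes R :: "'a \<Rightarrow> ereal"
  assumes [measurable]: "R \<in> borel_measurable M"
    and zero_one: "\<And>x :: real. prob {\<omega> \<in> space M. R \<omega> \<le> ereal x} = 0 \<or> prob {\<omega> \<in> space M. R \<omega> \<le> ereal x} = 1"
    and bounds: "AE \<omega> in M. ereal a \<le> R \<omega>" "AE \<omega> in M. R \<omega> \<le> ereal b"
  obtains L where "a \<le> L" "AE \<omega> in M. R \<omega> = ereal L"
proof -
  define S where "S = {x :: real. AE \<omega> in M. R \<omega> \<le> ereal x}"
  have alt: "(AE \<omega> in M. R \<omega> \<le> ereal x) \<or> (AE \<omega> in M. ereal x < R \<omega>)" for x
  proof -
    have "prob {\<omega> \<in> space M. R \<omega> \<le> ereal x} = 1 \<longleftrightarrow> (AE \<omega> in M. R \<omega> \<le> ereal x)"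
      by (rule prob_Collect_eq_1) measurable
    moreover have "prob {\<omega> \<in> space M. R \<omega> \<le> ereal x} = 0 \<longleftrightarrow> (AE \<omega> in M. \<not> R \<omega> \<le> ereal x)"
      by (rule prob_Collect_eq_0) measurable
    ultimately show ?thesis using zero_one[of x] unfolding not_le by metis
  qed
  have b: "b \<in> S" using bounds by (simp add: S_def)
  have a: "a \<le> x" if "x \<in> S" for x
  proof -
    have "AE \<omega> in M. R \<omega> \<le> ereal x" using that by (simp add: S_def)
    then have "AE \<omega> in M. ereal a \<le> ereal x" using bounds(1) by eventually_elim (rule order_trans)
    then show ?thesis by simp
  qed
  define L where "L = Inf S"
  have bdd: "bdd_below S" by (rule bdd_belowI) (rule a)
  have "a \<le> L" unfolding L_def using b a by (intro cInf_greatest) auto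
  moreover have "AE \<omega> in M. R \<omega> = ereal L"
  proof -
    have "AE \<omega> in M. R \<omega> \<le> ereal (L + 1 / Suc n)" for n
    proof -
      obtain x where x: "x \<in> S" "x < L + 1 / Suc n"
        using cInf_lessD[of S "L + 1 / Suc n"] b unfolding L_def by auto
      have "AE \<omega> in M. R \<omega> \<le> ereal x" using x(1) by (simp add: S_def)
      then show ?thesis
        by eventually_elim (use x(2) in \<open>auto intro: order_trans less_imp_le\<close>)
    qed
    moreover have "AE \<omega> in M. ereal (L - 1 / Suc n) \<le> R \<omega>" for n
    proof -
      have "L - 1 / Suc n \<notin> S"
        using cInf_lower[OF _ bdd, of "L - 1 / Suc n"] unfolding L_def[symmetric] by auto
      then show ?thesis using alt[of "L - 1 / Suc n"] by (auto simp: S_def elim!: AE_mp)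
    qed
    ultimately have "AE \<omega> in M. \<forall>n. R \<omega> \<le> ereal (L + 1 / Suc n) \<and> ereal (L - 1 / Suc n) \<le> R \<omega>"
      by (simp add: AE_all_countable)
    then show ?thesis
    proof eventually_elim
      case (elim \<omega>)
      have lim: "(\<lambda>n. ereal (L + 1 / Suc n)) \<longlonglongrightarrow> ereal (L + 0)" "(\<lambda>n. ereal (L - 1 / Suc n)) \<longlonglongrightarrow> ereal (L - 0)"
        by (intro tendsto_ereal tendsto_add tendsto_diff tendsto_const
            LIMSEQ_Suc[OF lim_1_over_n])+
      have "R \<omega> \<le> ereal (L + 0)" using elim by (intro LIMSEQ_le_const[OF lim(1)]) auto
      moreover have "ereal (L - 0) \<le> R \<omega>" using elim by (intro LIMSEQ_le_const2[OF lim(2)]) auto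
      ultimately show ?case by simp
    qed
  qed
  ultimately show thesis by (rule that)
qed

context perturbed_matrices
begin

text \<open>The growth rate after removal of the first \<open>k\<close> factors. It depends only on the noise after
time \<open>k\<close>.\<close>
definition growth_from :: "nat \<Rightarrow> 'w \<Rightarrow> ereal" where
  "growth_from k \<omega> = liminf (\<lambda>n. ereal (1 / real (n + k) *
    ln (eccentricity (perturbed_product (\<lambda>i. A (i + k)) (\<lambda>i. \<Xi> (i + k) \<omega>) \<epsilon> n))))"

text \<open>Where the products are invertible, the growth rates do not depend on \<open>k\<close>. Their upper limit
is a version of the growth rate that is exactly, not only almost surely, measurable with respect to
the tail.\<close>
definition tail_growth :: "'w \<Rightarrow> ereal" where
  "tail_growth \<omega> = limsup (\<lambda>k. growth_from k \<omega>)"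

lemma growth_from_eq:
  assumes nz: "\<And>n. det (cocycle n \<omega>) \<noteq> 0"
  shows "growth_from k \<omega> = growth_from 0 \<omega>"
proof -
  let ?S = "\<lambda>n. perturbed_product (\<lambda>i. A (i + k)) (\<lambda>i. \<Xi> (i + k) \<omega>) \<epsilon> n"
  have split: "cocycle (n + k) \<omega> = ?S n ** cocycle k \<omega>" for n
    unfolding cocycle_def by (rule perturbed_product_split)
  have S: "det (?S n) \<noteq> 0" for n
    using nz[of "n + k"] unfolding split det_mul by simp
  obtain C where C: "\<And>N. det N \<noteq> 0 \<Longrightarrow> \<bar>ln (eccentricity (N ** cocycle k \<omega>)) - ln (eccentricity N)\<bar> \<le> C"
    using bounded_distortion_right_factor[OF nz] by blast
  have "growth_from 0 \<omega> = liminf (\<lambda>n. ereal (1 / real n * ln (eccentricity (cocycle n \<omega>))))"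
    by (simp add: growth_from_def cocycle_def)
  also have "\<dots> = liminf (\<lambda>n. ereal (1 / real (n + k) * ln (eccentricity (cocycle (n + k) \<omega>))))"
    by (rule liminf_shift_k[symmetric])
  also have "\<dots> = growth_from k \<omega>"
    unfolding growth_from_def
    by (rule liminf_average_cong[where C = C]) (use C S in \<open>simp add: split\<close>)
  finally show ?thesis ..
qed

lemma tail_growth_eq:
  assumes "\<And>n. det (cocycle n \<omega>) \<noteq> 0"
  shows "tail_growth \<omega> = liminf (\<lambda>n. ereal (1 / real n * ln (eccentricity (cocycle n \<omega>))))"
proof -
  have "tail_growth \<omega> = limsup (\<lambda>k :: nat. growth_from 0 \<omega>)"
    unfolding tail_growth_def by (intro arg_cong[where f = limsup] ext growth_from_eq assms)
  then show ?thesis by (simp add: Limsup_const growth_from_def cocycle_def)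
qed

lemma liminf_singular_values_eq:
  assumes nz: "\<And>n. det (cocycle n \<omega>) \<noteq> 0"
  shows "liminf (\<lambda>n. ereal (1 / real n * ln (singular_value 1 (cocycle n \<omega>) / singular_value 2 (cocycle n \<omega>))))
    = tail_growth \<omega>"
  unfolding tail_growth_eq[OF nz]
  using liminf_average_cong[where k = 0 and C = "ln 2"
      and a = "\<lambda>n. ln (singular_value 1 (cocycle n \<omega>) / singular_value 2 (cocycle n \<omega>))"
      and b = "\<lambda>n. ln (eccentricity (cocycle n \<omega>))", OF abs_ln_ratio_singular_values_eccentricity[OF nz]]
  unfolding add_0_right .

lemma tail_growth_measurable_tail:
  assumes \<Xi>: "\<And>i. n \<le> i \<Longrightarrow> \<Xi> (Suc i) \<in> borel_measurable N"
  shows "tail_growth \<in> borel_measurable N"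
proof -
  have [measurable]: "growth_from (k + n) \<in> borel_measurable N" for k
  proof -
    have [measurable]: "(\<lambda>\<omega>. perturbed_product (\<lambda>i. A (i + (k + n))) (\<lambda>i. \<Xi> (i + (k + n)) \<omega>) \<epsilon> m)
        \<in> borel_measurable N" for m
    proof (rule measurable_perturbed_product)
      fix i assume "i \<in> {1..m}"
      then obtain j where "i = Suc j" by (cases i) auto
      then show "\<Xi> (i + (k + n)) \<in> borel_measurable N"
        using \<Xi>[of "j + (k + n)"] by simp
    qed
    show ?thesis unfolding growth_from_def[abs_def] by measurable
  qed
  have "tail_growth = (\<lambda>\<omega>. limsup (\<lambda>k. growth_from (k + n) \<omega>))"
    unfolding tail_growth_def[abs_def] by (intro ext limsup_shift_k[symmetric])
  also have "\<dots> \<in> borel_measurable N" by measurable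
  finally show ?thesis .
qed

lemma tail_growth_measurable [measurable]: "tail_growth \<in> borel_measurable P"
  by (rule tail_growth_measurable_tail[of 0]) (simp add: measurable_\<Xi>)

lemma tail_growth_zero_one:
  "prob {\<omega> \<in> space P. tail_growth \<omega> \<le> ereal x} = 0 \<or> prob {\<omega> \<in> space P. tail_growth \<omega> \<le> ereal x} = 1"
proof -
  define F where "F i = {\<Xi> (Suc i) -` B \<inter> space P | B. B \<in> sets borel}" for i
  have alg: "sigma_algebra (space P) (F i)" for i
    using sets.sigma_algebra_axioms[of "vimage_algebra (space P) (\<Xi> (Suc i)) borel"]
    by (simp add: F_def sets_vimage_algebra2)
  have indep: "indep_sets (\<lambda>i. {\<Xi> i -` B \<inter> space P | B. B \<in> sets borel}) {1..}"
    using noise by (simp add: independent_uniform_matrices_def indep_vars_def2)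
  have ind: "indep_sets F UNIV"
  proof (rule indep_setsI)
    show "F i \<subseteq> events" for i
      using measurable_\<Xi>[of "Suc i"] by (auto simp: F_def intro: measurable_sets)
    fix B J assume J: "J \<noteq> {}" "finite J" "\<forall>j\<in>J. B j \<in> F j"
    then show "prob (\<Inter>j\<in>J. B j) = (\<Prod>j\<in>J. prob (B j))"
      using indep_setsD[OF indep, of "Suc ` J" "\<lambda>i. B (i - 1)"]
      by (auto simp: F_def prod.reindex)
  qed
  have "{\<omega> \<in> space P. tail_growth \<omega> \<le> ereal x} \<in> tail_events F"
    unfolding tail_events_def
  proof
    fix n
    define N where "N = sigma (space P) (\<Union> (F ` {n..}))"
    have sub: "\<Union> (F ` {n..}) \<subseteq> Pow (space P)" by (auto simp: F_def)
    have sets_N: "sets N = sigma_sets (space P) (\<Union> (F ` {n..}))" and sp: "space N = space P"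
      using sub by (simp_all add: N_def)
    have "\<Xi> (Suc i) \<in> borel_measurable N" if "n \<le> i" for i
    proof (rule measurableI)
      fix B :: "(real^2^2) set" assume "B \<in> sets borel"
      then have "\<Xi> (Suc i) -` B \<inter> space P \<in> \<Union> (F ` {n..})"
        using that by (auto simp: F_def)
      then show "\<Xi> (Suc i) -` B \<inter> space N \<in> sets N" unfolding sets_N sp by (rule sigma_sets.Basic)
    qed simp
    then have [measurable]: "tail_growth \<in> borel_measurable N" by (rule tail_growth_measurable_tail)
    have "{\<omega> \<in> space N. tail_growth \<omega> \<le> ereal x} \<in> sets N" by measurable
    then show "{\<omega> \<in> space P. tail_growth \<omega> \<le> ereal x} \<in> sigma_sets (space P) (\<Union> (F ` {n..}))"
      by (simp add: sets_N sp)
  qed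
  then show ?thesis using kolmogorov_0_1_law[OF alg ind] by blast
qed

text \<open>The quotient \<open>X = \<surd>\<bar>det M\<bar> / norm M\<close> decays in the mean at the rate \<open>gap_factor\<^bsup>1/2\<^esup>\<close> and
hence almost surely at the slower rate \<open>gap_factor\<^bsup>1/4\<^esup>\<close>. The eccentricity is \<open>X\<^bsup>-2\<^esup>\<close>, so it grows at
the exponential rate \<open>- ln gap_factor / 2\<close>, which is at least \<open>(1 - gap_factor) / 2\<close>.\<close>
lemma AE_tail_growth_ge: "AE \<omega> in P. ereal (\<epsilon> ^ 8 / 2 ^ 57) \<le> tail_growth \<omega>"
proof -
  let ?X = "\<lambda>n \<omega>. sqrt \<bar>det (cocycle n \<omega>)\<bar> / norm (cocycle n \<omega>)"
  define q where "q = sqrt gap_factor"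
  have q: "0 < q" "q < 1" using gap_factor_bounds by (auto simp: q_def)
  have sq: "q < sqrt q"
    using q by (intro real_less_rsqrt) (simp add: power2_eq_square)
  have "AE \<omega> in P. eventually (\<lambda>n. ?X n \<omega> \<le> sqrt q ^ n) sequentially"
    by (rule AE_eventually_le_geometric[where C = 2 and \<theta> = q])
      (use expectation_sqrt_det_over_norm q sq in \<open>auto simp: q_def\<close>)
  with AE_det_nz show ?thesis
  proof eventually_elim
    case (elim \<omega>)
    then have nz: "\<And>n. det (cocycle n \<omega>) \<noteq> 0" by simp
    have ev: "eventually (\<lambda>n. \<epsilon> ^ 8 / 2 ^ 57 \<le> 1 / real n * ln (eccentricity (cocycle n \<omega>))) sequentially"
      using elim(2) eventually_gt_at_top[of 0]
    proof eventually_elim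
      case (elim n)
      have pos: "0 < norm (cocycle n \<omega>)" using norm_pos_of_det_nz[OF nz] .
      have X: "0 < ?X n \<omega>" using pos nz[of n] by simp
      have ecc: "eccentricity (cocycle n \<omega>) = inverse ((?X n \<omega>)\<^sup>2)"
        by (simp add: eccentricity_def power_divide)
      have "ln (?X n \<omega>) \<le> ln (sqrt q ^ n)" using elim X by (intro ln_mono)
      also have "\<dots> = real n * (ln gap_factor / 4)"
        using q gap_factor_bounds by (simp add: ln_realpow ln_sqrt q_def)
      also have "\<dots> \<le> real n * ((gap_factor - 1) / 4)"
        using ln_le_minus_one[of gap_factor] gap_factor_bounds
        by (intro mult_left_mono divide_right_mono) auto
      finally have "real n * (\<epsilon> ^ 8 / 2 ^ 56 / 4) \<le> - ln (?X n \<omega>)"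
        by (simp add: gap_factor_def)
      moreover have "ln (eccentricity (cocycle n \<omega>)) = - 2 * ln (?X n \<omega>)"
        unfolding ecc using X by (simp add: ln_inverse ln_realpow)
      ultimately show ?case using elim(2) by (simp add: field_simps)
    qed
    show ?case
      unfolding tail_growth_eq[OF nz]
      by (rule Liminf_bounded) (use ev in \<open>auto elim!: eventually_mono\<close>)
  qed
qed

lemma norm_cocycle_le:
  assumes "\<forall>n\<ge>1. \<forall>i j. \<bar>\<Xi> n \<omega> $ i $ j\<bar> \<le> 1"
  shows "norm (cocycle n \<omega>) \<le> 2 * 4 ^ n"
proof (induction n)
  case 0
  have "(norm (mat 1 :: real^2^2))\<^sup>2 \<le> 2\<^sup>2" by (simp add: norm_sq_mat2 mat_def)
  then have "norm (mat 1 :: real^2^2) \<le> 2" by (rule power2_le_imp_le) simp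
  then show ?case by (simp add: cocycle_0)
next
  case (Suc n)
  have "\<bar>factor (Suc n) \<omega> $ i $ j\<bar> \<le> 2" for i j
    unfolding factor_def using assms by (intro perturbed_entry_le A_entry_le \<epsilon>) auto
  then have "(factor (Suc n) \<omega> $ i $ j)\<^sup>2 \<le> 2\<^sup>2" for i j
    by (subst abs_le_square_iff[symmetric]) simp
  from add_mono[OF add_mono[OF this[of 1 1] this[of 1 2]] add_mono[OF this[of 2 1] this[of 2 2]]]
  have "(norm (factor (Suc n) \<omega>))\<^sup>2 \<le> 4\<^sup>2" unfolding norm_sq_mat2 by simp
  then have "norm (factor (Suc n) \<omega>) \<le> 4" by (rule power2_le_imp_le) simp
  then have "norm (factor (Suc n) \<omega>) * norm (cocycle n \<omega>) \<le> 4 * (2 * 4 ^ n)"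
    by (intro mult_mono Suc.IH) simp_all
  then show ?case
    unfolding cocycle_Suc using norm_matrix_mult_le[of "factor (Suc n) \<omega>" "cocycle n \<omega>"] by simp
qed

text \<open>The norm grows at most geometrically because the entries are bounded. The inverse square root
of the determinant does so almost surely, by its moments.\<close>
lemma AE_tail_growth_le: "AE \<omega> in P. tail_growth \<omega> \<le> ereal (2 * ln (400 / \<epsilon>))"
proof -
  let ?Y = "\<lambda>n \<omega>. 1 / sqrt \<bar>det (cocycle n \<omega>)\<bar>"
  have E: "(\<integral>\<^sup>+\<omega>. ennreal (?Y n \<omega>) \<partial>P) \<le> ennreal (1 * (25 / \<epsilon>) ^ n)" for n
  proof -
    have "(\<integral>\<^sup>+\<omega>. ennreal (?Y n \<omega>) \<partial>P) \<le> (\<integral>\<^sup>+\<omega>. inv_sqrt_det (cocycle n \<omega>) \<partial>P)"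
    proof (rule nn_integral_mono)
      fix \<omega> show "ennreal (?Y n \<omega>) \<le> inv_sqrt_det (cocycle n \<omega>)"
        by (cases "det (cocycle n \<omega>) = 0") (auto simp: inv_sqrt_det_def inverse_ennreal inverse_eq_divide)
    qed
    then show ?thesis using expectation_inv_sqrt_det_product[of n] by simp
  qed
  have "AE \<omega> in P. eventually (\<lambda>n. ?Y n \<omega> \<le> (50 / \<epsilon>) ^ n) sequentially"
    by (rule AE_eventually_le_geometric[OF _ _ E]) (use \<epsilon> in \<open>auto simp: field_simps\<close>)
  moreover have "AE \<omega> in P. \<forall>n\<ge>1. \<forall>i j. \<bar>\<Xi> n \<omega> $ i $ j\<bar> \<le> 1"
  proof (rule AE_all_countable[THEN iffD2], rule allI)
    fix n
    show "AE \<omega> in P. 1 \<le> n \<longrightarrow> (\<forall>i j. \<bar>\<Xi> n \<omega> $ i $ j\<bar> \<le> 1)"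
    proof (cases "1 \<le> n")
      case True
      from AE_\<Xi>_le[OF True] show ?thesis by eventually_elim simp
    qed simp
  qed
  ultimately show ?thesis using AE_det_nz
  proof eventually_elim
    case (elim \<omega>)
    then have nz: "\<And>n. det (cocycle n \<omega>) \<noteq> 0" by simp
    have ev: "eventually (\<lambda>n. 1 / real n * ln (eccentricity (cocycle n \<omega>)) \<le> 2 * ln (400 / \<epsilon>)) sequentially"
      using elim(1) eventually_gt_at_top[of 0]
    proof eventually_elim
      case (elim n)
      have pos: "0 < norm (cocycle n \<omega>)" using norm_pos_of_det_nz[OF nz] .
      have ecc: "eccentricity (cocycle n \<omega>) = (norm (cocycle n \<omega>) * ?Y n \<omega>)\<^sup>2"
        by (simp add: eccentricity_def power_divide power_mult_distrib)
      have "norm (cocycle n \<omega>) * ?Y n \<omega> \<le> (2 * 4 ^ n) * (50 / \<epsilon>) ^ n"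
        using \<open>\<forall>n\<ge>1. _\<close> elim(1) by (intro mult_mono norm_cocycle_le) auto
      also have "\<dots> \<le> (2 ^ n * 4 ^ n) * (50 / \<epsilon>) ^ n"
        using elim(2) \<epsilon> self_le_power[of "2 :: real" n] by (intro mult_right_mono) auto
      also have "\<dots> = (400 / \<epsilon>) ^ n" by (simp add: power_mult_distrib[symmetric])
      finally have "ln (norm (cocycle n \<omega>) * ?Y n \<omega>) \<le> ln ((400 / \<epsilon>) ^ n)"
        using pos nz[of n] by (intro ln_mono) auto
      also have "\<dots> = real n * ln (400 / \<epsilon>)" using \<epsilon> by (simp add: ln_realpow)
      finally have "ln (norm (cocycle n \<omega>) * ?Y n \<omega>) \<le> real n * ln (400 / \<epsilon>)" .
      moreover have "ln (eccentricity (cocycle n \<omega>)) = 2 * ln (norm (cocycle n \<omega>) * ?Y n \<omega>)"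
        unfolding ecc using pos nz[of n] by (subst ln_realpow) auto
      ultimately show ?case using elim(2) by (simp add: field_simps)
    qed
    have "tail_growth \<omega> \<le> limsup (\<lambda>n. ereal (1 / real n * ln (eccentricity (cocycle n \<omega>))))"
      unfolding tail_growth_eq[OF nz] by (rule Liminf_le_Limsup) simp
    also have "\<dots> \<le> ereal (2 * ln (400 / \<epsilon>))"
      by (rule Limsup_bounded) (use ev in \<open>auto elim!: eventually_mono\<close>)
    finally show ?case .
  qed
qed

lemma singular_value_ratio_growth:
  obtains L where "\<epsilon> ^ 8 / 2 ^ 57 \<le> L"
    "AE \<omega> in P. liminf (\<lambda>n. ereal (1 / real n *
       ln (singular_value 1 (cocycle n \<omega>) / singular_value 2 (cocycle n \<omega>)))) = ereal L"
proof -
  obtain L where L: "\<epsilon> ^ 8 / 2 ^ 57 \<le> L" "AE \<omega> in P. tail_growth \<omega> = ereal L"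
    using AE_constant_of_zero_one[OF tail_growth_measurable tail_growth_zero_one
        AE_tail_growth_ge AE_tail_growth_le] .
  have "AE \<omega> in P. liminf (\<lambda>n. ereal (1 / real n *
       ln (singular_value 1 (cocycle n \<omega>) / singular_value 2 (cocycle n \<omega>)))) = ereal L"
    using L(2) AE_det_nz
  proof eventually_elim
    case (elim \<omega>)
    then have nz: "\<And>n. det (cocycle n \<omega>) \<noteq> 0" by simp
    show ?case unfolding liminf_singular_values_eq[OF nz] by (rule elim(1))
  qed
  with L(1) show thesis by (rule that)
qed

end

theorem theorem1:
  shows "\<exists>c\<^sub>2 :: real \<Rightarrow> real.
    (\<forall>\<epsilon>. 0 < \<epsilon> \<and> \<epsilon> < 1 \<longrightarrow> c\<^sub>2 \<epsilon> > 0) \<and>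
    (\<forall>(P :: 'w measure) (\<Xi> :: nat \<Rightarrow> 'w \<Rightarrow> real^2^2).
      independent_uniform_matrices P \<Xi> \<longrightarrow>
      (\<forall>\<epsilon>. 0 < \<epsilon> \<and> \<epsilon> < 1 \<longrightarrow>
        (\<forall>A :: nat \<Rightarrow> real^2^2. (\<forall>n\<ge>1. onorm ((*v) (A n)) \<le> 1) \<longrightarrow>
          (\<exists>L :: real. L \<ge> c\<^sub>2 \<epsilon> \<and>
            (AE \<omega> in P.
              liminf (\<lambda>n. ereal (1 / real n *
                ln (singular_value 1 (perturbed_product A (\<lambda>k. \<Xi> k \<omega>) \<epsilon> n) /
                    singular_value 2 (perturbed_product A (\<lambda>k. \<Xi> k \<omega>) \<epsilon> n)))) = ereal L))))) \<and>
    (\<forall>\<^sub>F \<epsilon> in at_right 0. c\<^sub>2 \<epsilon> > exp (- 1 / \<epsilon> ^ 35))"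
proof (intro exI[of _ "\<lambda>\<epsilon>. \<epsilon> ^ 8 / 2 ^ 57"] conjI allI impI)
  fix \<epsilon> :: real
  assume "0 < \<epsilon> \<and> \<epsilon> < 1"
  then show "0 < \<epsilon> ^ 8 / 2 ^ 57" by simp
next
  fix P :: "'w measure" and \<Xi> :: "nat \<Rightarrow> 'w \<Rightarrow> real^2^2" and \<epsilon> :: real and A :: "nat \<Rightarrow> real^2^2"
  assume noise: "independent_uniform_matrices P \<Xi>" and \<epsilon>: "0 < \<epsilon> \<and> \<epsilon> < 1"
    and A: "\<forall>n\<ge>1. onorm ((*v) (A n)) \<le> 1"
  interpret prob_space P using noise by (simp add: independent_uniform_matrices_def)
  interpret perturbed_matrices P \<Xi> A \<epsilon>
    using noise \<epsilon> A by unfold_locales auto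
  show "\<exists>L. \<epsilon> ^ 8 / 2 ^ 57 \<le> L \<and> (AE \<omega> in P.
      liminf (\<lambda>n. ereal (1 / real n *
        ln (singular_value 1 (perturbed_product A (\<lambda>k. \<Xi> k \<omega>) \<epsilon> n) /
            singular_value 2 (perturbed_product A (\<lambda>k. \<Xi> k \<omega>) \<epsilon> n)))) = ereal L)"
    using singular_value_ratio_growth unfolding cocycle_def by blast
next
  show "\<forall>\<^sub>F \<epsilon> :: real in at_right 0. exp (- 1 / \<epsilon> ^ 35) < \<epsilon> ^ 8 / 2 ^ 57"
    by real_asymp
qed

end
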